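(* Consider the system $\dot u(t)=f_{t/\varepsilon}(u(t))$, with $f_\theta(u)$ 1-periodic in $\theta$, and let $\tilde\Phi^{[2]}_\theta$ be the change of variable defined implicitly by $$\tilde\Phi^{[2]}_\theta(v)=v+\varepsilon\,h_\theta\Big(\frac{\tilde\Phi^{[2]}_\theta(v)+v}{2}\Big),$$ where $$h_\theta=g_\theta+\varepsilon\int_0^\theta\Big(\partial_uf_\tau\,g_\tau-\langle\partial_uf\,g\rangle-(\partial_ug_\tau-\langle\partial_ug\rangle)\langle f\rangle\Big)d\tau-\frac{\varepsilon}{2}\,\partial_ug_\theta\,g_\theta,\qquad g_\theta(u)=\int_0^\theta\big(f_\tau(u)-\langle f\rangle(u)\big)d\tau.$$ Consider the associated pullback formulation $$\dot v=\big(\partial_u\tilde\Phi^{[2]}_{t/\varepsilon}(v)\big)^{-1}\Big(f_{t/\varepsilon}\circ\tilde\Phi^{[2]}_{t/\varepsilon}(v)-\frac1\varepsilon\,\partial_\theta\tilde\Phi^{[2]}_{t/\varepsilon}(v)\Big),\qquad v(0)=(\tilde\Phi^{[2]}_0)^{-1}(u(0)).$$ (i) If the original system has a quadratic first integral $I$, i.e. $I(u(t))=I(u(0))$, then the pullback formulation has the same quadratic first integral: $I(v(t))=I(v(0))$. (ii) If $f_\theta(u)=J^{-1}\nabla_uH_\theta(u)$ is a Hamiltonian vector field, then the pullback formulation is again Hamiltonian.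
   Context: Here $\varepsilon\in\,]0,1]$, $\theta\in\mathbb{T}=\mathbb{R}/\mathbb{Z}$, and $\langle g\rangle(u)=\int_0^1g_\theta(u)\,d\theta$ denotes the average over $\theta$ of a $\theta$-dependent map $g$; products such as $\partial_uf_\tau\,g_\tau$ mean $u\mapsto\partial_uf_\tau(u)\,g_\tau(u)$, and $\langle\partial_uf\,g\rangle=\int_0^1\partial_uf_\tau\,g_\tau\,d\tau$. The solution of the original system is recovered from that of the pullback formulation by $u(t)=\tilde\Phi^{[2]}_{t/\varepsilon}(v(t))$. The matrix $J$ is the usual symplectic structure matrix, and $H_\theta$ is a Hamiltonian function depending 1-periodically on $\theta$. The implicit relation is that of the implicit midpoint rule with vector field $h_\theta$ and step size $\varepsilon$. *)

theory Defs
  imports "HOL-Analysis.Analysis"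
begin

text \<open>
  Maps depending on \<open>\<theta>\<close> in the torus are functions of a real \<open>\<theta>\<close> that are 1-periodic. The vector field
  need only be defined on an open set \<open>U\<close> of the phase space \<open>real ^ 'm\<close> (values outside are ignored).
  Integrals over \<open>\<theta>\<close> are the library's oriented interval integrals, so negative \<open>\<theta>\<close> is covered.
\<close>

definition average :: "(real \<Rightarrow> 'b::{banach,second_countable_topology}) \<Rightarrow> 'b" where
  "average F = (LBINT \<theta>=0..1. F \<theta>)"

text \<open>
  Twice continuously differentiable in \<open>u\<close>, with the map and its two \<open>u\<close>-derivatives jointly continuous
  in \<open>(\<theta>, u)\<close>. This is what makes \<open>h\<close> below continuously differentiable in \<open>u\<close>; no
  differentiability in \<open>\<theta>\<close> is needed.
\<close>

definition smooth_field :: "(real ^ 'm) set \<Rightarrow> (real \<Rightarrow> real ^ 'm \<Rightarrow> real ^ 'm) \<Rightarrow> bool" where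
  "smooth_field U f \<longleftrightarrow>
     (\<exists>(f' :: real \<Rightarrow> real ^ 'm \<Rightarrow> (real ^ 'm) \<Rightarrow>\<^sub>L (real ^ 'm))
       (f'' :: real \<Rightarrow> real ^ 'm \<Rightarrow> (real ^ 'm) \<Rightarrow>\<^sub>L ((real ^ 'm) \<Rightarrow>\<^sub>L (real ^ 'm))).
        (\<forall>\<theta>. \<forall>u\<in>U. (f \<theta> has_derivative blinfun_apply (f' \<theta> u)) (at u)) \<and>
        (\<forall>\<theta>. \<forall>u\<in>U. (f' \<theta> has_derivative blinfun_apply (f'' \<theta> u)) (at u)) \<and>
        continuous_on (UNIV \<times> U) (\<lambda>(\<theta>, u). f \<theta> u) \<and>
        continuous_on (UNIV \<times> U) (\<lambda>(\<theta>, u). f' \<theta> u) \<and>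
        continuous_on (UNIV \<times> U) (\<lambda>(\<theta>, u). f'' \<theta> u))"

definition g_map :: "(real \<Rightarrow> real ^ 'm \<Rightarrow> real ^ 'm) \<Rightarrow> real \<Rightarrow> real ^ 'm \<Rightarrow> real ^ 'm" where
  "g_map f \<theta> u = (LBINT \<tau>=0..\<theta>. f \<tau> u - average (\<lambda>\<sigma>. f \<sigma> u))"

definition h_map ::
  "real \<Rightarrow> (real \<Rightarrow> real ^ 'm \<Rightarrow> real ^ 'm) \<Rightarrow> real \<Rightarrow> real ^ 'm \<Rightarrow> real ^ 'm" where
  "h_map \<epsilon> f \<theta> u =
     (let g = g_map f;
          df = (\<lambda>\<tau>. jacobian (f \<tau>) (at u));
          dg = (\<lambda>\<tau>. jacobian (g \<tau>) (at u))
      in g \<theta> u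
         + \<epsilon> *\<^sub>R (LBINT \<tau>=0..\<theta>. df \<tau> *v g \<tau> u - average (\<lambda>\<sigma>. df \<sigma> *v g \<sigma> u)
                        - (dg \<tau> - average dg) *v average (\<lambda>\<sigma>. f \<sigma> u))
         - (\<epsilon> / 2) *\<^sub>R (dg \<theta> *v g \<theta> u))"

text \<open>
  \<open>\<Phi>\<close> is a change of variable on the open set \<open>V\<close> given by the implicit midpoint relation. Solvability
  of the relation (which holds locally for small \<open>\<epsilon>\<close>) is not derived but built in: \<open>\<Phi>\<close> is some
  differentiable 1-periodic solution, each \<open>\<Phi> \<theta>\<close> being injective with invertible Jacobian.
\<close>

definition midpoint_change_of_variable ::
  "real \<Rightarrow> (real ^ 'm) set \<Rightarrow> (real \<Rightarrow> real ^ 'm \<Rightarrow> real ^ 'm) \<Rightarrow>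
   (real ^ 'm) set \<Rightarrow> (real \<Rightarrow> real ^ 'm \<Rightarrow> real ^ 'm) \<Rightarrow> bool" where
  "midpoint_change_of_variable \<epsilon> U f V \<Phi> \<longleftrightarrow>
     (\<forall>\<theta>. \<forall>v\<in>V. \<Phi> \<theta> v \<in> U \<and> midpoint (\<Phi> \<theta> v) v \<in> U \<and>
        \<Phi> \<theta> v = v + \<epsilon> *\<^sub>R h_map \<epsilon> f \<theta> (midpoint (\<Phi> \<theta> v) v)) \<and>
     (\<forall>\<theta>. \<forall>v\<in>V. \<Phi> (\<theta> + 1) v = \<Phi> \<theta> v) \<and>
     (\<lambda>(\<theta>, v). \<Phi> \<theta> v) differentiable_on (UNIV \<times> V) \<and>
     (\<forall>\<theta>. inj_on (\<Phi> \<theta>) V) \<and>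
     (\<forall>\<theta>. \<forall>v\<in>V. invertible (jacobian (\<Phi> \<theta>) (at v)))"

text \<open>The pullback formulation is \<open>v'(t) = pullback_field \<epsilon> f \<Phi> (t / \<epsilon>) (v t)\<close>.\<close>

definition pullback_field ::
  "real \<Rightarrow> (real \<Rightarrow> real ^ 'm \<Rightarrow> real ^ 'm) \<Rightarrow> (real \<Rightarrow> real ^ 'm \<Rightarrow> real ^ 'm) \<Rightarrow>
   real \<Rightarrow> real ^ 'm \<Rightarrow> real ^ 'm" where
  "pullback_field \<epsilon> f \<Phi> \<theta> v =
     matrix_inv (jacobian (\<Phi> \<theta>) (at v)) *v
       (f \<theta> (\<Phi> \<theta> v) - (1 / \<epsilon>) *\<^sub>R vector_derivative (\<lambda>\<sigma>. \<Phi> \<sigma> v) (at \<theta>))"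

definition ode_solution ::
  "(real \<Rightarrow> real ^ 'm \<Rightarrow> real ^ 'm) \<Rightarrow> (real ^ 'm) set \<Rightarrow> real set \<Rightarrow> (real \<Rightarrow> real ^ 'm) \<Rightarrow> bool" where
  "ode_solution F D T u \<longleftrightarrow>
     is_interval T \<and>
     (\<forall>t\<in>T. u t \<in> D \<and> (u has_vector_derivative F t (u t)) (at t within T))"

text \<open>
  Constancy along every solution in \<open>D\<close>, on whatever time interval. It is not enough to look at
  solutions issued from time 0: for a nonautonomous field whose solutions blow up, these need not
  visit all points of the extended phase space, and the conservation of \<open>I\<close> by the pullback can fail.
\<close>

definition first_integral ::
  "(real \<Rightarrow> real ^ 'm \<Rightarrow> real ^ 'm) \<Rightarrow> (real ^ 'm) set \<Rightarrow> (real ^ 'm \<Rightarrow> real) \<Rightarrow> bool" where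
  "first_integral F D I \<longleftrightarrow>
     (\<forall>T u. ode_solution F D T u \<longrightarrow> (\<forall>s\<in>T. \<forall>t\<in>T. I (u t) = I (u s)))"

text \<open>Quadratic is understood as polynomial of degree at most 2, linear terms being allowed.\<close>

definition quadratic_function :: "(real ^ 'm \<Rightarrow> real) \<Rightarrow> bool" where
  "quadratic_function I \<longleftrightarrow>
     (\<exists>(C :: real ^ 'm ^ 'm) b c. \<forall>u. I u = u \<bullet> (C *v u) + b \<bullet> u + c)"

text \<open>
  The matrix with blocks \<open>0, Id, - Id, 0\<close>, for the coordinates numbered by a bijection
  \<open>\<sigma> :: 'd + 'd \<Rightarrow> 'm\<close>: positions are the indices \<open>\<sigma> (Inl k)\<close>, momenta the indices \<open>\<sigma> (Inr k)\<close>.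
  The existence of \<open>\<sigma>\<close> says that the dimension is even.
\<close>

definition symplectic_matrix :: "('d::finite + 'd \<Rightarrow> 'm::finite) \<Rightarrow> real ^ 'm ^ 'm" where
  "symplectic_matrix \<sigma> =
     (\<chi> i j. \<Sum>k\<in>UNIV. of_bool (i = \<sigma> (Inl k) \<and> j = \<sigma> (Inr k))
                   - of_bool (i = \<sigma> (Inr k) \<and> j = \<sigma> (Inl k)))"

text \<open>
  \<open>F \<theta> u\<close> is the inverse of \<open>J\<close> applied to the gradient of \<open>H \<theta>\<close> at \<open>u\<close>, for some Hamiltonian \<open>H\<close>
  that is 1-periodic in \<open>\<theta>\<close>, jointly continuous, and defined on all of \<open>D\<close> (not only locally).
\<close>

definition hamiltonian_field ::
  "real ^ 'm ^ 'm \<Rightarrow> (real ^ 'm) set \<Rightarrow> (real \<Rightarrow> real ^ 'm \<Rightarrow> real ^ 'm) \<Rightarrow> bool" where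
  "hamiltonian_field J D F \<longleftrightarrow>
     (\<exists>H :: real \<Rightarrow> real ^ 'm \<Rightarrow> real.
        (\<forall>\<theta>. \<forall>u\<in>D. H (\<theta> + 1) u = H \<theta> u) \<and>
        continuous_on (UNIV \<times> D) (\<lambda>(\<theta>, u). H \<theta> u) \<and>
        (\<forall>\<theta>. \<forall>u\<in>D. \<exists>dH. GDERIV (H \<theta>) u :> dH \<and> F \<theta> u = matrix_inv J *v dH))"

end

theory Submission
  imports Defs
begin

text \<open>
  Write \<open>\<langle>\<cdot>\<rangle>\<close> for averages and \<open>[a, c] = a' c - c' a\<close> for the Lie bracket. Because \<open>g\<close> vanishes at 0 and
  at 1, integrating the total derivative of \<open>g' g\<close> rewrites \<open>h\<close> as the primitive of
  \<open>\<psi> = f - \<langle>f\<rangle> + \<epsilon>/2 ([k, g] - \<langle>[k, g]\<rangle>)\<close> with \<open>k = f + \<langle>f\<rangle>\<close>. Hence \<open>h\<close> inherits every property of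
  \<open>f\<close> that is stable under linear combinations, averages and brackets: being tangent to the level
  sets of \<open>I\<close>, and being Hamiltonian. In the first case the midpoint relation gives \<open>I \<circ> \<Phi> = I\<close>, and
  \<open>\<Phi>\<close> maps solutions of the pullback to solutions of the original system. In the second case \<open>\<Phi>\<close> is
  symplectic, and with \<open>\<eta>\<close> a Hamiltonian of \<open>\<psi>\<close>, the pullback has the globally defined Hamiltonian
  \<open>H (\<Phi> v) - \<eta> ((\<Phi> v + v) / 2)\<close>.
\<close>

subsection \<open>Families of maps depending on time\<close>

text \<open>Tangency to the level sets of \<open>I\<close> is needed at the midpoint, which lies on
  no given trajectory, whereas a first integral only constrains solutions. Hence local solutions are
  constructed through every point of the extended phase space, and tangency is obtained as a
  pointwise identity on \<open>U\<close>; being an identity on an open set it can be differentiated,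
  as brackets require. For the Hamiltonian part, \<open>U\<close> and \<open>V\<close> need not be
  simply connected and \<open>\<Phi>\<close> is only assumed differentiable, so neither a Poincare
  lemma nor second derivatives of \<open>\<Phi>\<close> are at hand. Instead an explicit global
  potential is carried through every operation; for a bracket of \<open>a\<close> and
  \<open>c\<close> it is the inner product of \<open>J a\<close> and \<open>c\<close>. That
  \<open>\<Phi>\<close> is symplectic is then linear algebra: its Jacobian is a Cayley transform of
  a multiple of the derivative of \<open>h\<close>. The term \<open>\<eta>\<close> in the final
  Hamiltonian comes from the time dependence of \<open>\<Phi>\<close>: paired with the symplectic
  form, the time derivative divided by \<open>\<epsilon>\<close> is the gradient of
  \<open>\<eta>\<close> taken at the midpoint.\<close>

text \<open>Rescaling to the unit interval orients the integral for negative \<open>\<theta>\<close> and fixes the domain of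
  integration for differentiation in the parameter.\<close>

definition primitive :: "(real \<Rightarrow> 'a \<Rightarrow> 'b::banach) \<Rightarrow> real \<Rightarrow> 'a \<Rightarrow> 'b" where
  "primitive F \<theta> u = \<theta> *\<^sub>R integral {0..1} (\<lambda>s. F (\<theta> * s) u)"

definition mean :: "(real \<Rightarrow> 'a \<Rightarrow> 'b::banach) \<Rightarrow> 'a \<Rightarrow> 'b" where
  "mean F u = integral {0..1} (\<lambda>s. F s u)"

lemma primitive_0 [simp]: "primitive F 0 u = 0"
  by (simp add: primitive_def)

lemma primitive_1: "primitive F 1 = mean F"
  by (simp add: fun_eq_iff primitive_def mean_def)

text \<open>The chain rule for \<open>Q (\<theta> * s)\<close> in \<open>s\<close> produces the
  factor \<open>\<theta>\<close> of the rescaled integral. The derivative of \<open>Q\<close> is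
  required only on the segment from 0 to \<open>\<theta>\<close>, so a local antiderivative is
  enough.\<close>

lemma primitive_eq_diff:
  fixes Q :: "real \<Rightarrow> 'b::banach"
  assumes "\<And>s. s \<in> {0..1} \<Longrightarrow> (Q has_vector_derivative F (\<theta> * s) u) (at (\<theta> * s))"
  shows "primitive F \<theta> u = Q \<theta> - Q 0"
proof -
  have "((\<lambda>s. Q (\<theta> * s)) has_vector_derivative \<theta> *\<^sub>R F (\<theta> * s) u) (at s within {0..1})"
    if "s \<in> {0..1}" for s
  proof -
    have "((\<lambda>s. \<theta> * s) has_vector_derivative \<theta>) (at s within {0..1})"
      by (auto intro!: derivative_eq_intros)
    then show ?thesis
      using vector_diff_chain_within[of "\<lambda>s. \<theta> * s" \<theta> s "{0..1}" Q "F (\<theta> * s) u"] assms[OF that]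
      by (simp add: o_def has_vector_derivative_at_within)
  qed
  then have "((\<lambda>s. \<theta> *\<^sub>R F (\<theta> * s) u) has_integral Q (\<theta> * 1) - Q (\<theta> * 0)) {0..1}"
    by (intro fundamental_theorem_of_calculus) auto
  then show ?thesis
    by (simp add: primitive_def integral_unique flip: integral_cmul)
qed

text \<open>Differentiating the rescaled integral directly would call for a time derivative of
  \<open>F\<close>. It is compared instead with an ordinary indefinite integral started at
  \<open>-R\<close>, where \<open>R\<close> is chosen so that both 0 and \<open>\<theta>\<close> are
  interior points.\<close>

lemma has_vector_derivative_primitive:
  assumes "continuous_on UNIV (\<lambda>\<theta>. F \<theta> u)"
  shows "((\<lambda>\<theta>. primitive F \<theta> u) has_vector_derivative F \<theta> u) (at \<theta>)"
proof -
  define R where "R = \<bar>\<theta>\<bar> + 1"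
  define Q where "Q x = integral {-R..x} (\<lambda>\<tau>. F \<tau> u)" for x
  have c: "continuous_on {-R..R} (\<lambda>\<theta>. F \<theta> u)"
    using assms continuous_on_subset by blast
  have Q: "(Q has_vector_derivative F x u) (at x)" if "x \<in> {-R<..<R}" for x
  proof -
    have "(Q has_vector_derivative F x u) (at x within {-R..R})"
      unfolding Q_def using that by (intro integral_has_vector_derivative c) auto
    then show ?thesis
      using that by (simp add: at_within_Icc_at)
  qed
  have "primitive F x u = Q x - Q 0" if x: "x \<in> {-R<..<R}" for x
  proof (rule primitive_eq_diff[of Q F x u])
    fix s :: real assume "s \<in> {0..1}"
    then have "\<bar>x * s\<bar> \<le> \<bar>x\<bar>"
      by (simp add: abs_mult mult_left_le)
    then have "x * s \<in> {-R<..<R}" using x by auto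
    then show "(Q has_vector_derivative F (x * s) u) (at (x * s))" by (rule Q)
  qed
  then have "Q x - Q 0 = primitive F x u" if "x \<in> {-R<..<R}" for x
    using that by simp
  moreover have "((\<lambda>x. Q x - Q 0) has_vector_derivative F \<theta> u) (at \<theta>)"
  proof -
    have "\<theta> \<in> {-R<..<R}" by (auto simp: R_def)
    from Q[OF this] show ?thesis by (auto intro!: derivative_eq_intros)
  qed
  moreover have "open {-R<..<R}" "\<theta> \<in> {-R<..<R}"
    by (auto simp: R_def)
  ultimately show ?thesis
    using has_vector_derivative_transform_within_open[of "\<lambda>x. Q x - Q 0" "F \<theta> u" \<theta> "{-R<..<R}"
        "\<lambda>\<theta>. primitive F \<theta> u"] by blast
qed

lemma primitive_eqI:
  fixes Q :: "real \<Rightarrow> 'b::banach"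
  assumes "\<And>\<tau>. (Q has_vector_derivative F \<tau> u) (at \<tau>)" and "Q 0 = 0"
  shows "primitive F \<theta> u = Q \<theta>"
  using primitive_eq_diff[of Q F \<theta> u] assms by simp

text \<open>Bridge from the oriented Lebesgue integrals of the statement to the rescaled ones; the
  parameter \<open>u\<close> is a dummy.\<close>

lemma LBINT_eq_primitive:
  fixes \<phi> :: "real \<Rightarrow> 'b::euclidean_space"
  assumes "continuous_on UNIV \<phi>"
  shows "(LBINT \<tau>=0..\<theta>. \<phi> \<tau>) = primitive (\<lambda>\<tau> u. \<phi> \<tau>) \<theta> u"
proof -
  define P where "P \<theta> = primitive (\<lambda>\<tau> u. \<phi> \<tau>) \<theta> u" for \<theta>
  have "(P has_vector_derivative \<phi> \<tau>) (at \<tau> within S)" for \<tau> S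
    unfolding P_def using has_vector_derivative_primitive[of "\<lambda>\<tau> u. \<phi> \<tau>", OF assms]
    by (rule has_vector_derivative_at_within)
  then have "(LBINT \<tau>=ereal 0..ereal \<theta>. \<phi> \<tau>) = P \<theta> - P 0"
    by (intro interval_integral_FTC_finite continuous_on_subset[OF assms]) auto
  then show ?thesis by (simp add: zero_ereal_def P_def)
qed

lemma average_eq_mean:
  fixes \<phi> :: "real \<Rightarrow> 'b::euclidean_space"
  assumes "continuous_on UNIV \<phi>"
  shows "average \<phi> = mean (\<lambda>\<tau> u. \<phi> \<tau>) u"
  using LBINT_eq_primitive[OF assms, of 1 u] by (simp add: average_def primitive_1 one_ereal_def)

section \<open>Families jointly continuous in time and phase variable\<close>

definition continuous_family :: "'a::topological_space set \<Rightarrow> (real \<Rightarrow> 'a \<Rightarrow> 'b::topological_space) \<Rightarrow> bool" where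
  "continuous_family U F \<longleftrightarrow> continuous_on (UNIV \<times> U) (\<lambda>(\<theta>, u). F \<theta> u)"

lemma continuous_family_compose:
  assumes "continuous_family U F" "continuous_on S \<alpha>" "continuous_on S \<beta>" "\<beta> ` S \<subseteq> U"
  shows "continuous_on S (\<lambda>x. F (\<alpha> x) (\<beta> x))"
  using continuous_on_compose2[OF assms(1)[unfolded continuous_family_def],
      of S "\<lambda>x. (\<alpha> x, \<beta> x)"] assms(2-4)
  by (auto intro: continuous_on_Pair)

lemma continuous_family_time:
  assumes "continuous_family U F" "u \<in> U"
  shows "continuous_on S (\<lambda>\<theta>. F \<theta> u)"
  using assms by (intro continuous_family_compose[OF assms(1)]) auto

lemma continuous_family_integrable:
  fixes F :: "real \<Rightarrow> 'a::topological_space \<Rightarrow> 'b::banach"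
  assumes "continuous_family U F" "u \<in> U"
  shows "(\<lambda>s. F (\<theta> * s) u) integrable_on {0..1}" "(\<lambda>s. F s u) integrable_on {0..1}"
  using assms
  by (auto intro!: integrable_continuous_real continuous_family_compose[OF assms(1)] continuous_intros)

lemma continuous_family_has_mean:
  fixes F :: "real \<Rightarrow> 'a::topological_space \<Rightarrow> 'b::banach"
  assumes "continuous_family U F" "u \<in> U"
  shows "((\<lambda>s. F s u) has_integral mean F u) {0..1}"
  unfolding mean_def using continuous_family_integrable(2)[OF assms] by blast

text \<open>Averages are treated as families that are constant in time, so that centred families
  such as \<open>f - mean f\<close> fall under the same closure rules as \<open>f\<close>.\<close>

lemma continuous_family_mean_constant:
  "continuous_family U F \<Longrightarrow> continuous_family U (\<lambda>_. mean F)"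
  for F :: "real \<Rightarrow> 'a::topological_space \<Rightarrow> 'b::banach"
  unfolding continuous_family_def[of U "\<lambda>_. mean F"] case_prod_beta
proof -
  assume F: "continuous_family U F"
  have "continuous_on ((UNIV \<times> U) \<times> cbox 0 1) (\<lambda>(x, s). F s (snd x))"
    unfolding case_prod_beta
    by (intro continuous_family_compose[OF F] continuous_intros) auto
  from integral_continuous_on_param[OF this]
  show "continuous_on (UNIV \<times> U) (\<lambda>p. mean F (snd p))"
    by (simp add: mean_def)
qed

lemma continuous_family_primitive:
  fixes F :: "real \<Rightarrow> 'a::topological_space \<Rightarrow> 'b::banach"
  assumes F: "continuous_family U F"
  shows "continuous_family U (primitive F)"
proof -
  have "continuous_on ((UNIV \<times> U) \<times> cbox 0 1) (\<lambda>(x, s). F (fst x * s) (snd x))"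
    unfolding case_prod_beta
    by (intro continuous_family_compose[OF F] continuous_intros) auto
  from integral_continuous_on_param[OF this]
  show ?thesis
    unfolding continuous_family_def primitive_def case_prod_beta
    by (intro continuous_intros) simp
qed

lemma primitive_linear:
  fixes F :: "real \<Rightarrow> 'a::topological_space \<Rightarrow> 'b::banach"
  assumes "bounded_linear L" "continuous_family U F" "u \<in> U"
  shows "L (primitive F \<theta> u) = primitive (\<lambda>\<theta> u. L (F \<theta> u)) \<theta> u"
  using integral_linear[OF continuous_family_integrable(1)[OF assms(2,3)] assms(1), of \<theta>]
  by (simp add: primitive_def linear_simps[OF assms(1)] o_def)

lemma mean_linear:
  fixes F :: "real \<Rightarrow> 'a::topological_space \<Rightarrow> 'b::banach"
  assumes "bounded_linear L" "continuous_family U F" "u \<in> U"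
  shows "L (mean F u) = mean (\<lambda>\<theta> u. L (F \<theta> u)) u"
  using primitive_linear[OF assms, of 1] by (simp add: primitive_1)

text \<open>The derivative is an explicit family with values in bounded linear maps: its joint
  continuity can be stated, and it can in turn be the first argument of \<open>C1_family\<close>,
  which is how \<open>f''\<close> enters. In time there is continuity only.\<close>

definition C1_family ::
  "'a::euclidean_space set \<Rightarrow> (real \<Rightarrow> 'a \<Rightarrow> 'b::banach) \<Rightarrow> (real \<Rightarrow> 'a \<Rightarrow> 'a \<Rightarrow>\<^sub>L 'b) \<Rightarrow> bool" where
  "C1_family U F F' \<longleftrightarrow>
     (\<forall>\<theta>. \<forall>u\<in>U. (F \<theta> has_derivative blinfun_apply (F' \<theta> u)) (at u)) \<and>
     continuous_family U F \<and> continuous_family U F'"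

lemma C1_family_cont:
  assumes "C1_family U F F'"
  shows "continuous_family U F" "continuous_family U F'"
  using assms by (auto simp: C1_family_def)

lemma C1_family_deriv:
  assumes "C1_family U F F'" "u \<in> U"
  shows "(F \<theta> has_derivative blinfun_apply (F' \<theta> u)) (at u)"
  using assms by (auto simp: C1_family_def)

lemma C1_family_add:
  "C1_family U F F' \<Longrightarrow> C1_family U G G' \<Longrightarrow>
    C1_family U (\<lambda>\<theta> u. F \<theta> u + G \<theta> u) (\<lambda>\<theta> u. F' \<theta> u + G' \<theta> u)"
  unfolding C1_family_def continuous_family_def case_prod_beta
  by (auto intro!: continuous_intros derivative_eq_intros simp: blinfun.bilinear_simps)

lemma C1_family_diff:
  "C1_family U F F' \<Longrightarrow> C1_family U G G' \<Longrightarrow>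
    C1_family U (\<lambda>\<theta> u. F \<theta> u - G \<theta> u) (\<lambda>\<theta> u. F' \<theta> u - G' \<theta> u)"
  unfolding C1_family_def continuous_family_def case_prod_beta
  by (auto intro!: continuous_intros derivative_eq_intros simp: blinfun.bilinear_simps)

lemma C1_family_scaleR:
  "C1_family U F F' \<Longrightarrow> C1_family U (\<lambda>\<theta> u. c *\<^sub>R F \<theta> u) (\<lambda>\<theta> u. c *\<^sub>R F' \<theta> u)"
  unfolding C1_family_def continuous_family_def case_prod_beta
  by (auto intro!: continuous_intros derivative_eq_intros simp: blinfun.bilinear_simps)

lemma C1_family_primitive:
  fixes F :: "real \<Rightarrow> 'a::euclidean_space \<Rightarrow> 'b::banach"
  assumes "open U" and F: "C1_family U F F'"
  shows "C1_family U (primitive F) (primitive F')"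
  unfolding C1_family_def
proof (intro conjI allI ballI)
  fix \<theta> u assume "u \<in> U"
  then obtain r where r: "r > 0" "ball u r \<subseteq> U"
    using \<open>open U\<close> openE by blast
  \<comment> \<open>The Leibniz rule asks for a convex parameter set, hence the ball inside
    \<open>U\<close>.\<close>
  have "((\<lambda>u. integral (cbox 0 1) (\<lambda>s. F (\<theta> * s) u)) has_derivative
      blinfun_apply (integral (cbox 0 1) (\<lambda>s. F' (\<theta> * s) u))) (at u within ball u r)"
  proof (rule leibniz_rule)
    show "continuous_on (ball u r \<times> cbox 0 1) (\<lambda>(x, t). F' (\<theta> * t) x)"
      unfolding case_prod_beta using r
      by (intro continuous_family_compose[OF C1_family_cont(2)[OF F]] continuous_intros) auto
  qed (use r F in \<open>auto intro!: has_derivative_at_withinI C1_family_deriv[OF F]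
         continuous_family_integrable(1)[OF C1_family_cont(1)[OF F]]\<close>)
  then have "((\<lambda>u. integral {0..1} (\<lambda>s. F (\<theta> * s) u)) has_derivative
      blinfun_apply (integral {0..1} (\<lambda>s. F' (\<theta> * s) u))) (at u)"
    using r(1) by (simp add: at_within_open[of u "ball u r"])
  then show "(primitive F \<theta> has_derivative blinfun_apply (primitive F' \<theta> u)) (at u)"
    unfolding primitive_def[abs_def]
    by (auto intro!: derivative_eq_intros simp: blinfun.bilinear_simps)
qed (use F in \<open>auto intro: continuous_family_primitive simp: C1_family_def\<close>)

lemma C1_family_mean:
  fixes F :: "real \<Rightarrow> 'a::euclidean_space \<Rightarrow> 'b::banach"
  assumes "open U" and F: "C1_family U F F'"
  shows "C1_family U (\<lambda>_. mean F) (\<lambda>_. mean F')"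
proof -
  have "(mean F has_derivative blinfun_apply (mean F' u)) (at u)" if "u \<in> U" for u
    using C1_family_deriv[OF C1_family_primitive[OF assms] that, of 1]
    by (simp add: primitive_1)
  then show ?thesis
    using C1_family_cont[OF F] by (auto simp: C1_family_def continuous_family_mean_constant)
qed

text \<open>Product rule for evaluating an operator family at a vector family. The derivative stays
  existential, since for terms such as \<open>k' g\<close> only its existence and continuity
  matter.\<close>

lemma C1_family_apply:
  fixes G :: "real \<Rightarrow> 'a::euclidean_space \<Rightarrow> 'a" and A :: "real \<Rightarrow> 'a \<Rightarrow> 'a \<Rightarrow>\<^sub>L 'b::banach"
  assumes A: "C1_family U A A'" and G: "C1_family U G G'"
  shows "\<exists>D. C1_family U (\<lambda>\<theta> u. blinfun_apply (A \<theta> u) (G \<theta> u)) D"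
proof -
  define D where "D \<theta> u = Blinfun (\<lambda>y. A' \<theta> u y (G \<theta> u) + A \<theta> u (G' \<theta> u y))" for \<theta> u
  have D: "blinfun_apply (D \<theta> u) = (\<lambda>y. A' \<theta> u y (G \<theta> u) + A \<theta> u (G' \<theta> u y))" for \<theta> u
    unfolding D_def
    by (intro bounded_linear_Blinfun_apply bounded_linear_intros)
  note [intro!] = A[THEN C1_family_cont(1), unfolded continuous_family_def case_prod_beta]
    A[THEN C1_family_cont(2), unfolded continuous_family_def case_prod_beta]
    G[THEN C1_family_cont(1), unfolded continuous_family_def case_prod_beta]
    G[THEN C1_family_cont(2), unfolded continuous_family_def case_prod_beta]
  have "C1_family U (\<lambda>\<theta> u. blinfun_apply (A \<theta> u) (G \<theta> u)) D"
    unfolding C1_family_def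
  proof (intro conjI allI ballI)
    fix \<theta> u assume u: "u \<in> U"
    show "((\<lambda>u. A \<theta> u (G \<theta> u)) has_derivative D \<theta> u) (at u)"
      unfolding D
      using blinfun.FDERIV[OF C1_family_deriv[OF A u] C1_family_deriv[OF G u], of \<theta> \<theta>]
      by (simp add: add.commute)
  next
    show "continuous_family U (\<lambda>\<theta> u. A \<theta> u (G \<theta> u))"
      unfolding continuous_family_def case_prod_beta
      by (intro continuous_intros) auto
  next
    show "continuous_family U D"
      unfolding continuous_family_def case_prod_beta
      by (intro continuous_on_blinfun_componentwise)
         (auto simp: D intro!: continuous_intros)
  qed
  then show ?thesis by blast
qed

subsection \<open>Local solutions and quadratic first integrals\<close>

text \<open>The Picard operator is a contraction on bounded continuous functions on the whole line, since
  time is clamped to the interval of length \<open>\<delta>\<close>.\<close>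

lemma global_picard:
  fixes F :: "real \<Rightarrow> 'a::banach \<Rightarrow> 'a"
  assumes cont: "continuous_on UNIV (\<lambda>(t, x). F t x)"
    and lip: "\<And>t x y. norm (F t x - F t y) \<le> L * norm (x - y)"
    and bound: "\<And>t x. norm (F t x) \<le> M"
    and \<delta>: "0 < \<delta>" "\<delta> * L < 1" and "0 \<le> L"
  shows "\<exists>x. x 0 = u0 \<and>
     (\<forall>t\<in>{0..\<delta>}. (x has_vector_derivative F t (x t)) (at t within {0..\<delta>}) \<and>
        norm (x t - u0) \<le> M * t)"
proof -
  define c where "c t = max 0 (min \<delta> t)" for t
  have c: "c t \<in> {0..\<delta>}" for t using \<delta>(1) by (auto simp: c_def)
  have c_cont: "continuous_on UNIV c" unfolding c_def[abs_def] by (intro continuous_intros)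
  have M: "0 \<le> M" using bound[of 0 0] norm_ge_zero order_trans by blast
  have F: "continuous_on S (\<lambda>s. F s (apply_bcontfun x s))" for x S
    using continuous_on_compose2[OF cont, of S "\<lambda>s. (s, apply_bcontfun x s)"]
    by (simp add: continuous_on_Pair)
  define P where "P x t = u0 + integral {0..c t} (\<lambda>s. F s (apply_bcontfun x s))" for x t
  have P: "P x \<in> bcontfun" for x
  proof (rule bcontfun_normI)
    have "continuous_on {0..\<delta>} (\<lambda>t. integral {0..t} (\<lambda>s. F s (apply_bcontfun x s)))"
      by (intro indefinite_integral_continuous_1 integrable_continuous_real F)
    then show "continuous_on UNIV (P x)"
      unfolding P_def[abs_def] using c c_cont
      by (intro continuous_intros continuous_on_compose2[where g="\<lambda>t. integral {0..t} _" and f=c]) auto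
    show "norm (P x t) \<le> norm u0 + M * \<delta>" for t
    proof -
      have "norm (integral {0..c t} (\<lambda>s. F s (apply_bcontfun x s))) \<le> M * (c t - 0)"
        using c[of t] by (intro integral_bound F) (auto simp: bound)
      also have "\<dots> \<le> M * \<delta>" using c[of t] M by (intro mult_left_mono) auto
      finally show ?thesis
        unfolding P_def by (meson norm_triangle_le add_left_mono)
    qed
  qed
  have "dist (Bcontfun (P x)) (Bcontfun (P y)) \<le> (\<delta> * L) * dist x y" for x y
  proof (rule dist_bound)
    fix t
    have "norm (integral {0..c t} (\<lambda>s. F s (apply_bcontfun x s) - F s (apply_bcontfun y s)))
        \<le> L * dist x y * (c t - 0)"
    proof (intro integral_bound ballI)
      show "norm (F s (apply_bcontfun x s) - F s (apply_bcontfun y s)) \<le> L * dist x y" for s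
        using \<open>0 \<le> L\<close> dist_bounded[of x s y]
        by (intro order_trans[OF lip] mult_left_mono) (auto simp: dist_norm)
    qed (use c[of t] in \<open>auto intro!: continuous_intros F\<close>)
    also have "\<dots> \<le> L * dist x y * \<delta>"
      using c[of t] \<open>0 \<le> L\<close> by (intro mult_left_mono) auto
    finally show "dist (apply_bcontfun (Bcontfun (P x)) t) (apply_bcontfun (Bcontfun (P y)) t)
        \<le> (\<delta> * L) * dist x y"
      by (simp add: Bcontfun_inverse P, simp add: P_def dist_norm integral_diff F integrable_continuous_real mult.commute mult.left_commute)
  qed
  with banach_fix_type[of "\<delta> * L" "\<lambda>x. Bcontfun (P x)"] \<delta> \<open>0 \<le> L\<close>
  obtain x where "Bcontfun (P x) = x" by auto
  then have x: "apply_bcontfun x t = P x t" for t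
    by (metis Bcontfun_inverse P)
  \<comment> \<open>Without the clamp, \<open>X\<close> is a plain indefinite integral to which the
    fundamental theorem applies; on the interval from 0 to \<open>\<delta>\<close> it agrees with
    the fixed point \<open>x\<close>.\<close>
  define X where "X t = u0 + integral {0..t} (\<lambda>s. F s (apply_bcontfun x s))" for t
  have X: "X t = apply_bcontfun x t" if "t \<in> {0..\<delta>}" for t
    using that by (simp add: x[of t]) (simp add: X_def P_def c_def)
  have "(X has_vector_derivative F t (X t)) (at t within {0..\<delta>})" if "t \<in> {0..\<delta>}" for t
    unfolding X[OF that] unfolding X_def[abs_def]
    using integral_has_vector_derivative[OF F that, of x] by (auto intro!: derivative_eq_intros)
  moreover have "norm (X t - u0) \<le> M * t" if "t \<in> {0..\<delta>}" for t
    using that integral_bound[of 0 t "\<lambda>s. F s (apply_bcontfun x s)" M] F bound by (simp add: X_def)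
  ultimately show ?thesis
    by (intro exI[of _ X]) (auto simp: X_def)
qed

lemma continuous_family_bounded:
  fixes G :: "real \<Rightarrow> 'a::heine_borel \<Rightarrow> 'b::real_normed_vector"
  assumes "continuous_family U G" and "cball u0 r \<subseteq> U"
  shows "\<exists>B. \<forall>t\<in>{a..b}. \<forall>u\<in>cball u0 r. norm (G t u) \<le> B"
proof -
  have "bounded ((\<lambda>(t, u). G t u) ` ({a..b} \<times> cball u0 r))"
    using assms unfolding continuous_family_def
    by (intro compact_imp_bounded compact_continuous_image)
       (auto intro!: compact_Times elim: continuous_on_subset)
  then show ?thesis
    by (fastforce simp: bounded_iff)
qed

text \<open>Projecting onto a closed ball, which is nonexpansive, and clamping time turn
  \<open>F\<close> into a globally bounded and Lipschitz field \<open>G\<close>. Its solution solves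
  the original equation as long as it stays in the ball, where the projection is the
  identity.\<close>

lemma local_solution_exists:
  fixes F :: "real \<Rightarrow> real ^ 'm \<Rightarrow> real ^ 'm"
  assumes "open U" "u0 \<in> U" and F: "C1_family U F F'"
  shows "\<exists>\<delta>>0. \<exists>x. x t0 = u0 \<and> ode_solution F U {t0..t0 + \<delta>} x"
proof -
  obtain r where r: "r > 0" "cball u0 r \<subseteq> U"
    using assms(1,2) open_contains_cball by blast
  obtain M where M: "\<And>t u. t \<in> {t0..t0 + 1} \<Longrightarrow> u \<in> cball u0 r \<Longrightarrow> norm (F t u) \<le> M"
    using continuous_family_bounded[OF C1_family_cont(1)[OF F] r(2)] by blast
  obtain L where L: "\<And>t u. t \<in> {t0..t0 + 1} \<Longrightarrow> u \<in> cball u0 r \<Longrightarrow> norm (F' t u) \<le> L"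
    using continuous_family_bounded[OF C1_family_cont(2)[OF F] r(2)] by blast
  have LM: "0 \<le> M" "0 \<le> L"
    using order_trans[OF norm_ge_zero M[of t0 u0]] order_trans[OF norm_ge_zero L[of t0 u0]] r by auto
  define p where "p = closest_point (cball u0 r)"
  define c where "c t = t0 + max 0 (min 1 t)" for t :: real
  define G where "G t u = F (c t) (p u)" for t u
  have p: "p u \<in> cball u0 r" for u
    unfolding p_def using r by (intro closest_point_in_set) auto
  have c: "c t \<in> {t0..t0 + 1}" for t by (auto simp: c_def)
  have p_cont: "continuous_on S p" for S
    unfolding p_def using r by (intro continuous_on_closest_point) auto
  have G1: "continuous_on UNIV (\<lambda>(t, u). G t u)"
    unfolding G_def case_prod_beta using p r
    by (intro continuous_family_compose[OF C1_family_cont(1)[OF F]]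
        continuous_on_compose2[OF p_cont]) (auto simp: c_def intro!: continuous_intros)
  have G2: "norm (G t x - G t y) \<le> L * norm (x - y)" for t x y
  proof -
    have "norm (F (c t) (p x) - F (c t) (p y)) \<le> L * norm (p x - p y)"
    proof (rule differentiable_bound[of "cball u0 r"])
      show "(F (c t) has_derivative F' (c t) u) (at u within cball u0 r)" if "u \<in> cball u0 r" for u
        using has_derivative_at_withinI[OF C1_family_deriv[OF F]] that r(2) by blast
      show "onorm (F' (c t) u) \<le> L" if "u \<in> cball u0 r" for u
        using L[OF c that] by (simp add: norm_blinfun.rep_eq)
    qed (use p in auto)
    also have "\<dots> \<le> L * norm (x - y)"
      using closest_point_lipschitz[of "cball u0 r" x y] r LM
      by (intro mult_left_mono) (auto simp: p_def dist_norm)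
    finally show ?thesis by (simp add: G_def)
  qed
  have G3: "norm (G t x) \<le> M" for t x
    using M[OF c p] by (simp add: G_def)
  \<comment> \<open>The three bounds keep time within the clamp, make the Picard operator a
    contraction, and keep the solution in the ball of radius \<open>r\<close>; the added 1 avoids
    division by zero.\<close>
  define \<delta> where "\<delta> = min 1 (min (1 / (2 * (L + 1))) (r / (M + 1)))"
  have \<delta>: "0 < \<delta>" "\<delta> \<le> 1" "\<delta> \<le> 1 / (2 * (L + 1))" "\<delta> \<le> r / (M + 1)"
    using LM r by (auto simp: \<delta>_def)
  have \<delta>L: "\<delta> * L < 1"
  proof -
    have "\<delta> * L \<le> 1 / (2 * (L + 1)) * L" using \<delta> LM by (intro mult_right_mono) auto
    also have "\<dots> < 1" using LM by (simp add: field_simps)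
    finally show ?thesis .
  qed
  obtain x where x: "x 0 = u0"
    "\<And>t. t \<in> {0..\<delta>} \<Longrightarrow> (x has_vector_derivative G t (x t)) (at t within {0..\<delta>})"
    "\<And>t. t \<in> {0..\<delta>} \<Longrightarrow> norm (x t - u0) \<le> M * t"
    using global_picard[OF G1 G2 G3 \<delta>(1) \<delta>L LM(2), of u0] by blast
  have x_in: "x t \<in> cball u0 r" if "t \<in> {0..\<delta>}" for t
  proof -
    have "norm (x t - u0) \<le> M * t" using x(3) that .
    also have "\<dots> \<le> (M + 1) * \<delta>" using that LM by (intro mult_mono) auto
    also have "\<dots> \<le> r" using \<delta>(4) LM by (simp add: field_simps)
    finally show ?thesis by (simp add: dist_norm norm_minus_commute)
  qed
  have "((\<lambda>t. x (t - t0)) has_vector_derivative F t (x (t - t0))) (at t within {t0..t0 + \<delta>})"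
    if t: "t \<in> {t0..t0 + \<delta>}" for t
  proof -
    have t': "t - t0 \<in> {0..\<delta>}" using t by auto
    have "G (t - t0) (x (t - t0)) = F t (x (t - t0))"
      using t \<delta> closest_point_self[OF x_in[OF t']] by (simp add: G_def c_def p_def)
    then have "(x has_vector_derivative F t (x (t - t0))) (at (t - t0) within {0..\<delta>})"
      using x(2)[OF t'] by simp
    moreover have "(\<lambda>t. t - t0) ` {t0..t0 + \<delta>} = {0..\<delta>}"
      by (auto simp: image_iff intro!: bexI[of _ "_ + t0"])
    moreover have "((\<lambda>t. t - t0) has_vector_derivative 1) (at t within {t0..t0 + \<delta>})"
      by (auto intro!: derivative_eq_intros)
    ultimately show ?thesis
      using vector_diff_chain_within[of "\<lambda>t. t - t0" 1 t "{t0..t0 + \<delta>}" x "F t (x (t - t0))"]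
      by (simp add: o_def)
  qed
  then have "ode_solution F U {t0..t0 + \<delta>} (\<lambda>t. x (t - t0))"
    using x_in r by (auto simp: ode_solution_def is_interval_cc)
  then show ?thesis using x(1) \<delta>(1) by (intro exI[of _ \<delta>] conjI exI[of _ "\<lambda>t. x (t - t0)"]) auto
qed

text \<open>Along a solution started at time \<open>t\<close> in \<open>u\<close>, the function
  \<open>I\<close> is constant, while the chain rule gives its derivative as
  \<open>N \<bullet> F t u\<close>. The one-sided derivative at the initial time already determines
  the value.\<close>

lemma first_integral_imp_orthogonal:
  fixes F :: "real \<Rightarrow> real ^ 'm \<Rightarrow> real ^ 'm"
  assumes "open U" "u \<in> U" and F: "C1_family U F F'"
    and I: "first_integral F U I" and N: "(I has_derivative (\<lambda>y. N \<bullet> y)) (at u)"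
  shows "N \<bullet> F t u = 0"
proof -
  obtain \<delta> x where x: "\<delta> > 0" "x t = u" "ode_solution F U {t..t + \<delta>} x"
    using local_solution_exists[OF assms(1-3)] by blast
  define T where "T = {t..t + \<delta>}"
  have t: "t \<in> T" using x(1) by (simp add: T_def)
  have const: "I u = I (x s)" if "s \<in> T" for s
    using I x(2,3) that t unfolding first_integral_def T_def by metis
  have "((\<lambda>s. I u) has_vector_derivative 0) (at t within T)"
    by simp
  then have 1: "((\<lambda>s. I (x s)) has_vector_derivative 0) (at t within T)"
    using has_vector_derivative_transform[OF t, of "\<lambda>s. I (x s)" "\<lambda>s. I u" 0] const by simp
  have "(x has_derivative (\<lambda>h. h *\<^sub>R F t u)) (at t within T)"
    using x(2,3) t unfolding ode_solution_def has_vector_derivative_def T_def by auto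
  from has_derivative_compose[OF this, of I "\<lambda>y. N \<bullet> y"] N x(2)
  have 2: "((\<lambda>s. I (x s)) has_vector_derivative N \<bullet> F t u) (at t within T)"
    by (simp add: has_vector_derivative_def)
  show ?thesis
    using vector_derivative_unique_within_closed_interval[of t "t + \<delta>" t] 1 2 x(1) t
    unfolding T_def by (simp add: cbox_interval)
qed

lemma quadratic_has_derivative:
  fixes C :: "real ^ 'm ^ 'm"
  shows "((\<lambda>u. u \<bullet> (C *v u) + b \<bullet> u + c) has_derivative
    (\<lambda>y. ((C + transpose C) *v u + b) \<bullet> y)) (at u)"
proof -
  have 1: "((\<lambda>u. C *v u) has_derivative (\<lambda>y. C *v y)) (at u)"
    by (intro bounded_linear_imp_has_derivative matrix_vector_mul_bounded_linear)
  have "((\<lambda>u. u \<bullet> (C *v u) + b \<bullet> u + c) has_derivative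
    (\<lambda>y. (u \<bullet> (C *v y) + y \<bullet> (C *v u)) + b \<bullet> y + 0)) (at u)"
    by (intro has_derivative_add has_derivative_inner[OF has_derivative_ident 1]
        has_derivative_const has_derivative_inner_right has_derivative_ident)
  moreover have "(u \<bullet> (C *v y) + y \<bullet> (C *v u)) + b \<bullet> y + 0 = ((C + transpose C) *v u + b) \<bullet> y" for y
    by (simp add: matrix_vector_mult_add_rdistrib inner_add_left dot_lmul_matrix
        inner_commute[of y])
  ultimately show ?thesis by simp
qed

text \<open>This identity is why the implicit midpoint rule preserves quadratic invariants.\<close>

lemma quadratic_diff_midpoint:
  fixes C :: "real ^ 'm ^ 'm" and b v w :: "real ^ 'm" and c :: real
  defines "I \<equiv> \<lambda>u. u \<bullet> (C *v u) + b \<bullet> u + c"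
  shows "I w - I v = ((C + transpose C) *v midpoint w v + b) \<bullet> (w - v)"
proof -
  have "(C + transpose C) *v midpoint w v = (1/2) *\<^sub>R (C *v w + C *v v + transpose C *v w + transpose C *v v)"
    by (simp add: midpoint_def matrix_vector_mult_add_rdistrib matrix_vector_right_distrib
        matrix_vector_mult_scaleR scaleR_add_right)
  then show ?thesis
    by (simp add: I_def inner_add_left inner_add_right inner_diff_right dot_lmul_matrix
        inner_commute[of "C *v _"] add_divide_distrib diff_divide_distrib)
qed

subsection \<open>Averages, brackets and Hamiltonian families\<close>

text \<open>The mixed second difference of \<open>H\<close> in directions \<open>a\<close> and
  \<open>b\<close> is symmetric in them, and equals \<open>t\<^sup>2 * (Q b \<bullet> a)\<close> up
  to a small multiple of \<open>t\<^sup>2\<close>. Differentiability of the gradient at the single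
  point \<open>u\<close> suffices, so no continuity of second derivatives is involved.\<close>

lemma second_derivative_symmetric:
  fixes H :: "'a::real_inner \<Rightarrow> real" and q :: "'a \<Rightarrow> 'a"
  assumes "open U" "u \<in> U"
    and H: "\<And>w. w \<in> U \<Longrightarrow> (H has_derivative (\<lambda>x. q w \<bullet> x)) (at w)"
    and q: "(q has_derivative Q) (at u)"
  shows "Q x \<bullet> y = Q y \<bullet> x"
proof -
  interpret Q: bounded_linear Q
    using q by (rule has_derivative_bounded_linear)
  obtain r where r: "r > 0" "ball u r \<subseteq> U"
    using assms(1,2) openE by blast
  define K where "K = norm x + norm y + 1"
  have K: "K > 0" by (simp add: K_def add_nonneg_pos)
  have "\<bar>Q x \<bullet> y - Q y \<bullet> x\<bar> \<le> e" if "e > 0" for e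
  proof -
    \<comment> \<open>The second difference is estimated twice, with the directions exchanged, each
      time with error \<open>2 * e' * t\<^sup>2 * K * K\<close>; the factor 4 makes the total
      \<open>t\<^sup>2 * e\<close>.\<close>
    define e' where "e' = e / (4 * K * K)"
    have e': "e' > 0" using that K by (simp add: e'_def)
    obtain d where d: "d > 0"
      "\<And>w. norm (w - u) < d \<Longrightarrow> norm (q w - q u - Q (w - u)) \<le> e' * norm (w - u)"
      using q e' unfolding has_derivative_at_alt by blast
    define t where "t = min r d / (2 * K)"
    have t: "t > 0" "t * K < r" "t * K < d"
      using r d K by (auto simp: t_def)
    have main: "\<bar>H (u + t *\<^sub>R a + t *\<^sub>R b) - H (u + t *\<^sub>R a) - H (u + t *\<^sub>R b) + H u - t\<^sup>2 * (Q b \<bullet> a)\<bar>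
        \<le> 2 * e' * t\<^sup>2 * K * K"
      if ab: "norm a + norm b \<le> K" for a b
    proof -
      \<comment> \<open>The second difference is an increment of \<open>\<phi>\<close> from 0 to 1.
        The mean value theorem reduces it to a difference of \<open>q\<close> at two points whose
        displacements from \<open>u\<close> differ by \<open>t *\<^sub>R b\<close>; expanding
        \<open>q\<close> at \<open>u\<close> then leaves the term in \<open>Q b\<close> and two
        remainders.\<close>
      define \<phi> where "\<phi> s = H (u + t *\<^sub>R b + s *\<^sub>R (t *\<^sub>R a)) - H (u + s *\<^sub>R (t *\<^sub>R a))" for s
      have small: "norm (c *\<^sub>R (t *\<^sub>R b) + s *\<^sub>R (t *\<^sub>R a)) \<le> t * K" if "s \<in> {0..1}" "c \<in> {0..1}" for s c
      proof -
        have "norm (c *\<^sub>R (t *\<^sub>R b) + s *\<^sub>R (t *\<^sub>R a)) \<le> c * (t * norm b) + s * (t * norm a)"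
          using norm_triangle_ineq[of "c *\<^sub>R (t *\<^sub>R b)" "s *\<^sub>R (t *\<^sub>R a)"] that t by simp
        also have "\<dots> \<le> 1 * (t * norm b) + 1 * (t * norm a)"
          using that t by (intro add_mono mult_right_mono) auto
        also have "\<dots> = t * (norm a + norm b)" by (simp add: algebra_simps)
        also have "\<dots> \<le> t * K" using ab t by simp
        finally show ?thesis .
      qed
      have in_U: "u + (c *\<^sub>R (t *\<^sub>R b) + s *\<^sub>R (t *\<^sub>R a)) \<in> U" if "s \<in> {0..1}" "c \<in> {0..1}" for s c
      proof -
        have "dist u (u + z) = norm z" for z :: 'a
          by (simp add: dist_norm)
        then show ?thesis
          using small[OF that] t by (intro subsetD[OF r(2)]) (simp del: scaleR_scaleR)
      qed
      have "(\<phi> has_derivative (\<lambda>h. (q (u + t *\<^sub>R b + s *\<^sub>R (t *\<^sub>R a)) - q (u + s *\<^sub>R (t *\<^sub>R a))) \<bullet> (h *\<^sub>R (t *\<^sub>R a))))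
          (at s within {0..1})" if "s \<in> {0..1}" for s
      proof -
        have 1: "((\<lambda>s. H (u + t *\<^sub>R b + s *\<^sub>R (t *\<^sub>R a))) has_derivative
           (\<lambda>h. q (u + t *\<^sub>R b + s *\<^sub>R (t *\<^sub>R a)) \<bullet> (h *\<^sub>R (t *\<^sub>R a)))) (at s within {0..1})"
          using in_U[OF that, of 1]
          by (intro has_derivative_compose[OF _ H]) (auto intro!: derivative_eq_intros simp: add.assoc)
        have 2: "((\<lambda>s. H (u + s *\<^sub>R (t *\<^sub>R a))) has_derivative
           (\<lambda>h. q (u + s *\<^sub>R (t *\<^sub>R a)) \<bullet> (h *\<^sub>R (t *\<^sub>R a)))) (at s within {0..1})"
          using in_U[OF that, of 0]
          by (intro has_derivative_compose[OF _ H]) (auto intro!: derivative_eq_intros)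
        show ?thesis
          using has_derivative_diff[OF 1 2] by (simp add: \<phi>_def[abs_def] inner_diff_left right_diff_distrib)
      qed
      from mvt_simple[of 0 1 \<phi>, OF _ this] obtain s where s: "s \<in> {0<..<1}"
        "\<phi> 1 - \<phi> 0 = (q (u + t *\<^sub>R b + s *\<^sub>R (t *\<^sub>R a)) - q (u + s *\<^sub>R (t *\<^sub>R a))) \<bullet> (t *\<^sub>R a)"
        by auto
      define z1 where "z1 = t *\<^sub>R b + s *\<^sub>R (t *\<^sub>R a)"
      define z2 where "z2 = s *\<^sub>R (t *\<^sub>R a)"
      have z: "norm z1 \<le> t * K" "norm z2 \<le> t * K"
        using small[of s 1] small[of s 0] s(1) by (auto simp: z1_def z2_def)
      define R1 where "R1 = q (u + z1) - q u - Q z1"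
      define R2 where "R2 = q (u + z2) - q u - Q z2"
      have R: "norm R1 \<le> e' * (t * K)" "norm R2 \<le> e' * (t * K)"
        using order_trans[OF d(2)[of "u + z1"] mult_left_mono[of _ "t * K" e']]
          order_trans[OF d(2)[of "u + z2"] mult_left_mono[of _ "t * K" e']] z t e'
        by (auto simp: R1_def R2_def)
      have "\<phi> 1 - \<phi> 0 = (R1 - R2 + Q (t *\<^sub>R b)) \<bullet> (t *\<^sub>R a)"
        unfolding s(2) R1_def R2_def by (simp add: z1_def z2_def Q.add add.assoc)
      then have "\<phi> 1 - \<phi> 0 - t\<^sup>2 * (Q b \<bullet> a) = (R1 - R2) \<bullet> (t *\<^sub>R a)"
        by (simp add: Q.scaleR inner_add_left power2_eq_square algebra_simps)
      moreover have "\<bar>(R1 - R2) \<bullet> (t *\<^sub>R a)\<bar> \<le> (2 * (e' * (t * K))) * (t * K)"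
      proof -
        have "\<bar>(R1 - R2) \<bullet> (t *\<^sub>R a)\<bar> \<le> norm (R1 - R2) * norm (t *\<^sub>R a)"
          by (rule Cauchy_Schwarz_ineq2)
        also have "\<dots> \<le> (2 * (e' * (t * K))) * (t * K)"
        proof (rule mult_mono)
          show "norm (R1 - R2) \<le> 2 * (e' * (t * K))"
            using R norm_triangle_ineq4[of R1 R2] by linarith
          show "norm (t *\<^sub>R a) \<le> t * K"
            using ab t norm_ge_zero[of b] by (simp del: norm_ge_zero)
        qed (use e' t K in auto)
        finally show ?thesis .
      qed
      moreover have "\<phi> 1 - \<phi> 0 = H (u + t *\<^sub>R a + t *\<^sub>R b) - H (u + t *\<^sub>R a) - H (u + t *\<^sub>R b) + H u"
        by (simp add: \<phi>_def algebra_simps)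
      ultimately show ?thesis
        by (simp add: power2_eq_square mult.assoc mult.left_commute)
    qed
    have "\<bar>t\<^sup>2 * (Q x \<bullet> y - Q y \<bullet> x)\<bar> \<le> 4 * e' * t\<^sup>2 * K * K"
      using main[of x y] main[of y x]
      by (simp add: K_def algebra_simps)
    also have "4 * e' * t\<^sup>2 * K * K = t\<^sup>2 * e"
      using K by (simp add: e'_def)
    finally show ?thesis
      using t(1) by (simp add: abs_mult)
  qed
  then have "\<bar>Q x \<bullet> y - Q y \<bullet> x\<bar> \<le> 0"
    by (rule dense_ge)
  then show ?thesis by simp
qed

lemma C1_family_cong:
  assumes "open U" and F: "C1_family U F F'"
    and eq: "\<And>\<theta> u. u \<in> U \<Longrightarrow> F \<theta> u = G \<theta> u" "\<And>\<theta> u. u \<in> U \<Longrightarrow> F' \<theta> u = G' \<theta> u"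
  shows "C1_family U G G'"
  unfolding C1_family_def
proof (intro conjI allI ballI)
  fix \<theta> u assume u: "u \<in> U"
  show "(G \<theta> has_derivative G' \<theta> u) (at u)"
    using has_derivative_transform_within_open[OF C1_family_deriv[OF F u] \<open>open U\<close> u eq(1)]
    by (simp add: eq(2)[OF u])
next
  show "continuous_family U G"
    using C1_family_cont(1)[OF F] eq(1) unfolding continuous_family_def
    by (subst continuous_on_cong[OF refl, of _ _ "\<lambda>(\<theta>, u). F \<theta> u"]) auto
  show "continuous_family U G'"
    using C1_family_cont(2)[OF F] eq(2) unfolding continuous_family_def
    by (subst continuous_on_cong[OF refl, of _ _ "\<lambda>(\<theta>, u). F' \<theta> u"]) auto
qed

lemma mean_centred:
  fixes F :: "real \<Rightarrow> 'a::topological_space \<Rightarrow> 'b::banach"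
  assumes "continuous_family U F" "u \<in> U"
  shows "mean (\<lambda>\<theta> u. F \<theta> u - mean F u) u = 0"
  using continuous_family_integrable(2)[OF assms]
  by (simp add: mean_def integral_diff[OF _ integrable_const_ivl])

text \<open>The shifted primitive has the same derivative as the original one, and it vanishes at 0
  because its value there is the mean.\<close>

lemma primitive_periodic:
  fixes F :: "real \<Rightarrow> 'a::topological_space \<Rightarrow> 'b::banach"
  assumes "continuous_family U F" "u \<in> U" and "\<And>\<theta>. F (\<theta> + 1) u = F \<theta> u" and "mean F u = 0"
  shows "primitive F (\<theta> + 1) u = primitive F \<theta> u"
proof -
  define P where "P \<theta> = primitive F \<theta> u" for \<theta>
  have "(P has_vector_derivative F (\<tau> + 1) u) (at (\<tau> + 1))" for \<tau>
    unfolding P_def by (rule has_vector_derivative_primitive[of F u, OF continuous_family_time[OF assms(1,2)]])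
  moreover have "((\<lambda>\<tau>. \<tau> + 1 :: real) has_vector_derivative 1) (at \<tau>)" for \<tau>
    by (auto intro!: derivative_eq_intros)
  ultimately have "((\<lambda>\<tau>. P (\<tau> + 1)) has_vector_derivative F \<tau> u) (at \<tau>)" for \<tau>
    using vector_diff_chain_at[of "\<lambda>\<tau>. \<tau> + 1" 1 \<tau> P "F (\<tau> + 1) u"]
    by (simp add: o_def assms(3))
  moreover have "P (0 + 1) = 0"
    using assms(4) by (simp add: P_def primitive_1)
  ultimately show ?thesis
    using primitive_eqI[of "\<lambda>\<tau>. P (\<tau> + 1)" F u \<theta>] by (simp add: P_def)
qed

section \<open>Jacobian matrices versus bounded linear maps\<close>

lemma jacobian_C1_family:
  fixes F :: "real \<Rightarrow> real ^ 'm \<Rightarrow> real ^ 'm"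
  assumes "C1_family U F F'" "u \<in> U"
  shows "jacobian (F \<theta>) (at u) = matrix (blinfun_apply (F' \<theta> u))"
    "jacobian (F \<theta>) (at u) *v x = F' \<theta> u x"
proof -
  show "jacobian (F \<theta>) (at u) = matrix (blinfun_apply (F' \<theta> u))"
    using frechet_derivative_at[OF C1_family_deriv[OF assms], of \<theta>] by (simp add: jacobian_def)
  then show "jacobian (F \<theta>) (at u) *v x = F' \<theta> u x"
    by (simp add: matrix_works bounded_linear.linear[OF blinfun.bounded_linear_right])
qed

lemma continuous_on_matrix_blinfun:
  fixes A :: "'a::topological_space \<Rightarrow> (real ^ 'n) \<Rightarrow>\<^sub>L (real ^ 'm)"
  assumes "continuous_on S A"
  shows "continuous_on S (\<lambda>x. matrix (blinfun_apply (A x)))"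
  unfolding matrix_def using assms
  by (intro continuous_intros)

lemma bounded_linear_matrix_vector_left:
  "bounded_linear (\<lambda>M :: real ^ 'n ^ 'm. M *v x)"
  by (intro linear_conv_bounded_linear[THEN iffD1] linearI)
     (simp_all add: matrix_vector_mult_add_rdistrib scaleR_matrix_vector_assoc)

text \<open>The statement of the theorem averages matrices, the proof averages bounded linear maps.
  The two are compared after application to a vector, a linear operation that commutes with both
  integrals.\<close>

lemma average_jacobian:
  fixes F :: "real \<Rightarrow> real ^ 'm \<Rightarrow> real ^ 'm"
  assumes "C1_family U F F'" "u \<in> U"
  shows "average (\<lambda>\<theta>. jacobian (F \<theta>) (at u)) *v x = mean F' u x"
proof -
  note cF' = C1_family_cont(2)[OF assms(1)]
  define A where "A \<theta> = matrix (blinfun_apply (F' \<theta> u))" for \<theta>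
  have A: "continuous_on UNIV A"
    unfolding A_def by (intro continuous_on_matrix_blinfun continuous_family_time[OF cF' assms(2)])
  have "A integrable_on {0..1}"
    using A continuous_on_subset by (intro integrable_continuous_real) blast
  from integral_linear[OF this, of "\<lambda>M. M *v x"]
  have "integral {0..1} (\<lambda>\<theta>. A \<theta> *v x) = integral {0..1} A *v x"
    using bounded_linear_matrix_vector_left[of x]
    by (simp add: o_def)
  moreover have "integral {0..1} (\<lambda>\<theta>. A \<theta> *v x) = mean F' u x"
    using mean_linear[OF blinfun.bounded_linear_left cF' assms(2), of x]
    by (simp add: A_def matrix_works bounded_linear.linear[OF blinfun.bounded_linear_right] mean_def)
  moreover have "average (\<lambda>\<theta>. jacobian (F \<theta>) (at u)) = integral {0..1} A"
    using average_eq_mean[OF A] jacobian_C1_family(1)[OF assms] by (simp add: A_def[abs_def] mean_def)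
  ultimately show ?thesis by simp
qed

lemma inner_primitive_eq_0:
  fixes F :: "real \<Rightarrow> 'a::topological_space \<Rightarrow> 'b::euclidean_space"
  assumes "continuous_family U F" "u \<in> U" "\<And>\<theta>. n \<bullet> F \<theta> u = 0"
  shows "n \<bullet> primitive F \<theta> u = 0"
  using primitive_linear[OF bounded_linear_inner_right[of n] assms(1,2), of \<theta>]
  by (simp add: primitive_def assms(3))

lemma inner_mean_eq_0:
  fixes F :: "real \<Rightarrow> 'a::topological_space \<Rightarrow> 'b::euclidean_space"
  assumes "continuous_family U F" "u \<in> U" "\<And>\<theta>. n \<bullet> F \<theta> u = 0"
  shows "n \<bullet> mean F u = 0"
  using inner_primitive_eq_0[OF assms, of 1] by (simp add: primitive_1)

text \<open>Here \<open>S w + b\<close> plays the gradient of a quadratic \<open>I\<close>.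
  Differentiating the tangency identity of a field \<open>d\<close> trades the term with
  \<open>d'\<close> for one with \<open>S\<close>; in the bracket the two resulting terms cancel
  because \<open>S\<close>, the Hessian of \<open>I\<close>, is symmetric.\<close>

lemma bracket_tangent:
  fixes S :: "'a::real_inner \<Rightarrow> 'a"
  assumes "open U" "u \<in> U" and S: "bounded_linear S" "\<And>x y. S x \<bullet> y = x \<bullet> S y"
    and a: "(a has_derivative a') (at u)" "\<And>w. w \<in> U \<Longrightarrow> (S w + b) \<bullet> a w = 0"
    and c: "(c has_derivative c') (at u)" "\<And>w. w \<in> U \<Longrightarrow> (S w + b) \<bullet> c w = 0"
  shows "(S u + b) \<bullet> (a' (c u) - c' (a u)) = 0"
proof -
  have *: "(S u + b) \<bullet> d' y = - (S y \<bullet> d u)"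
    if d: "(d has_derivative d') (at u)" "\<And>w. w \<in> U \<Longrightarrow> (S w + b) \<bullet> d w = 0" for d d' y
  proof -
    have S': "((\<lambda>w. S w + b) has_derivative S) (at u)"
      using has_derivative_add[OF bounded_linear_imp_has_derivative[OF S(1)] has_derivative_const[of b]]
      by simp
    have "((\<lambda>w. (S w + b) \<bullet> d w) has_derivative (\<lambda>y. (S u + b) \<bullet> d' y + S y \<bullet> d u)) (at u)"
      by (rule has_derivative_inner[OF S' d(1)])
    moreover have "((\<lambda>w. (S w + b) \<bullet> d w) has_derivative (\<lambda>y. 0)) (at u)"
      by (rule has_derivative_transform_within_open[OF has_derivative_const[of 0] \<open>open U\<close> \<open>u \<in> U\<close>])
         (simp add: d(2))
    ultimately have "(\<lambda>y. (S u + b) \<bullet> d' y + S y \<bullet> d u) = (\<lambda>y. 0)"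
      by (rule has_derivative_unique)
    then show ?thesis
      by (simp add: fun_eq_iff eq_neg_iff_add_eq_0)
  qed
  show ?thesis
    using *[OF a, of "c u"] *[OF c, of "a u"] S(2)[of "c u" "a u"]
    by (simp add: inner_diff_right inner_commute)
qed

text \<open>The relation says that \<open>J a\<close> is the gradient of \<open>A\<close>, which
  avoids the inverse of \<open>J\<close>. It is linear in the pair of \<open>a\<close> and
  \<open>A\<close>, so its closure under sums, primitives and means follows from that of
  \<open>C1_family\<close>.\<close>

definition hamiltonian_family ::
  "real ^ 'm ^ 'm \<Rightarrow> (real ^ 'm) set \<Rightarrow> (real \<Rightarrow> real ^ 'm \<Rightarrow> real ^ 'm) \<Rightarrow> (real \<Rightarrow> real ^ 'm \<Rightarrow> real) \<Rightarrow> bool"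
  where "hamiltonian_family J U a A \<longleftrightarrow> C1_family U A (\<lambda>\<theta> u. blinfun_inner_right (J *v a \<theta> u))"

lemma bounded_linear_inner_right_matrix:
  "bounded_linear (\<lambda>x. blinfun_inner_right ((J :: real ^ 'm ^ 'm) *v x))"
  by (intro bounded_linear_compose[OF bounded_linear_blinfun_inner_right] matrix_vector_mul_bounded_linear)

lemma hamiltonian_family_add:
  "hamiltonian_family J U a A \<Longrightarrow> hamiltonian_family J U c C \<Longrightarrow>
    hamiltonian_family J U (\<lambda>\<theta> u. a \<theta> u + c \<theta> u) (\<lambda>\<theta> u. A \<theta> u + C \<theta> u)"
  unfolding hamiltonian_family_def linear_simps[OF bounded_linear_inner_right_matrix]
  by (rule C1_family_add)

lemma hamiltonian_family_diff:
  "hamiltonian_family J U a A \<Longrightarrow> hamiltonian_family J U c C \<Longrightarrow>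
    hamiltonian_family J U (\<lambda>\<theta> u. a \<theta> u - c \<theta> u) (\<lambda>\<theta> u. A \<theta> u - C \<theta> u)"
  unfolding hamiltonian_family_def linear_simps[OF bounded_linear_inner_right_matrix]
  by (rule C1_family_diff)

lemma hamiltonian_family_scaleR:
  "hamiltonian_family J U a A \<Longrightarrow>
    hamiltonian_family J U (\<lambda>\<theta> u. r *\<^sub>R a \<theta> u) (\<lambda>\<theta> u. r *\<^sub>R A \<theta> u)"
  unfolding hamiltonian_family_def linear_simps[OF bounded_linear_inner_right_matrix]
  by (rule C1_family_scaleR)

lemma hamiltonian_family_primitive:
  assumes "open U" "hamiltonian_family J U a A" "continuous_family U a"
  shows "hamiltonian_family J U (primitive a) (primitive A)"
  unfolding hamiltonian_family_def
proof (rule C1_family_cong[OF \<open>open U\<close> C1_family_primitive[OF \<open>open U\<close> assms(2)[unfolded hamiltonian_family_def]]])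
  show "primitive (\<lambda>\<theta> u. blinfun_inner_right (J *v a \<theta> u)) \<theta> u = blinfun_inner_right (J *v primitive a \<theta> u)"
    if "u \<in> U" for \<theta> :: real and u
    using primitive_linear[OF bounded_linear_inner_right_matrix assms(3) that, of J] by simp
qed simp

lemma hamiltonian_family_mean:
  assumes "open U" "hamiltonian_family J U a A" "continuous_family U a"
  shows "hamiltonian_family J U (\<lambda>_. mean a) (\<lambda>_. mean A)"
  unfolding hamiltonian_family_def
proof (rule C1_family_cong[OF \<open>open U\<close> C1_family_mean[OF \<open>open U\<close> assms(2)[unfolded hamiltonian_family_def]]])
  show "mean (\<lambda>\<theta> u. blinfun_inner_right (J *v a \<theta> u)) u = blinfun_inner_right (J *v mean a u)"
    if "u \<in> U" for \<theta> :: real and u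
    using mean_linear[OF bounded_linear_inner_right_matrix assms(3) that, of J] by simp
qed simp

text \<open>\<open>J a'\<close> is the Hessian of the potential \<open>A\<close>.\<close>

lemma hamiltonian_family_symmetric:
  assumes "open U" "u \<in> U" and A: "hamiltonian_family J U a A" and a: "C1_family U a a'"
  shows "(J *v a' \<theta> u x) \<bullet> y = (J *v a' \<theta> u y) \<bullet> x"
proof (rule second_derivative_symmetric[OF \<open>open U\<close> \<open>u \<in> U\<close>])
  show "(A \<theta> has_derivative (\<lambda>x. (J *v a \<theta> w) \<bullet> x)) (at w)" if "w \<in> U" for w
    using C1_family_deriv[OF A[unfolded hamiltonian_family_def] that, of \<theta>] by simp
  show "((\<lambda>w. J *v a \<theta> w) has_derivative (\<lambda>x. J *v a' \<theta> u x)) (at u)"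
    by (rule bounded_linear.has_derivative[OF matrix_vector_mul_bounded_linear
          C1_family_deriv[OF a \<open>u \<in> U\<close>]])
qed

text \<open>The potential is the derivative of \<open>A\<close> along \<open>c\<close>, that is, up
  to sign, the Poisson bracket of \<open>A\<close> and \<open>C\<close>. In its derivative, symmetry
  of the Hessians moves the direction \<open>y\<close> out of \<open>a'\<close> and
  \<open>c'\<close>, and skewness of \<open>J\<close> supplies the minus sign of the Lie
  bracket.\<close>

lemma hamiltonian_family_bracket:
  assumes "open U" and J: "\<And>x y. (J *v x) \<bullet> y = - (x \<bullet> (J *v y))"
    and A: "hamiltonian_family J U a A" and a: "C1_family U a a'"
    and C: "hamiltonian_family J U c C" and c: "C1_family U c c'"
  shows "hamiltonian_family J U (\<lambda>\<theta> u. a' \<theta> u (c \<theta> u) - c' \<theta> u (a \<theta> u)) (\<lambda>\<theta> u. (J *v a \<theta> u) \<bullet> c \<theta> u)"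
proof -
  note cont [continuous_intros] =
    a[THEN C1_family_cont(1), unfolded continuous_family_def case_prod_beta]
    a[THEN C1_family_cont(2), unfolded continuous_family_def case_prod_beta]
    c[THEN C1_family_cont(1), unfolded continuous_family_def case_prod_beta]
    c[THEN C1_family_cont(2), unfolded continuous_family_def case_prod_beta]
    bounded_linear.continuous_on[OF matrix_vector_mul_bounded_linear]
    bounded_linear.continuous_on[OF bounded_linear_inner_right_matrix]
  show ?thesis
    unfolding hamiltonian_family_def C1_family_def
  proof (intro conjI allI ballI)
    fix \<theta> u assume u: "u \<in> U"
    have "((\<lambda>u. (J *v a \<theta> u) \<bullet> c \<theta> u) has_derivative
        (\<lambda>y. (J *v a \<theta> u) \<bullet> c' \<theta> u y + (J *v a' \<theta> u y) \<bullet> c \<theta> u)) (at u)"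
      by (intro has_derivative_inner bounded_linear.has_derivative[OF matrix_vector_mul_bounded_linear]
          C1_family_deriv[OF a u] C1_family_deriv[OF c u])
    moreover have "(J *v a \<theta> u) \<bullet> c' \<theta> u y + (J *v a' \<theta> u y) \<bullet> c \<theta> u
        = (J *v (a' \<theta> u (c \<theta> u) - c' \<theta> u (a \<theta> u))) \<bullet> y" for y
      using hamiltonian_family_symmetric[OF \<open>open U\<close> u A a, of \<theta> y "c \<theta> u"]
        hamiltonian_family_symmetric[OF \<open>open U\<close> u C c, of \<theta> y "a \<theta> u"]
        J[of "a \<theta> u" "c' \<theta> u y"]
      by (simp add: linear_simps[OF matrix_vector_mul_bounded_linear] inner_diff_right inner_diff_left inner_commute)
    ultimately show "((\<lambda>u. (J *v a \<theta> u) \<bullet> c \<theta> u) has_derivative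
        blinfun_apply (blinfun_inner_right (J *v (a' \<theta> u (c \<theta> u) - c' \<theta> u (a \<theta> u))))) (at u)"
      by simp
  next
    show "continuous_family U (\<lambda>\<theta> u. (J *v a \<theta> u) \<bullet> c \<theta> u)"
      unfolding continuous_family_def case_prod_beta by (intro cont continuous_on_inner)
    show "continuous_family U (\<lambda>\<theta> u. blinfun_inner_right (J *v (a' \<theta> u (c \<theta> u) - c' \<theta> u (a \<theta> u))))"
      unfolding continuous_family_def case_prod_beta
      by (intro bounded_linear.continuous_on[OF bounded_linear_inner_right_matrix]
          continuous_on_diff blinfun.continuous_on cont)
  qed
qed

section \<open>Matrix inverses, rescaled time and the symplectic matrix\<close>

lemma matrix_inv_mult:
  fixes A :: "real ^ 'n ^ 'm"
  assumes "invertible A"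
  shows "A *v (matrix_inv A *v x) = x" "matrix_inv A *v (A *v y) = y"
proof -
  have "A ** matrix_inv A = mat 1 \<and> matrix_inv A ** A = mat 1"
    unfolding matrix_inv_def using assms unfolding invertible_def by (rule someI_ex)
  then show "A *v (matrix_inv A *v x) = x" "matrix_inv A *v (A *v y) = y"
    by (simp_all add: matrix_vector_mul_assoc)
qed

text \<open>The equation runs in the time \<open>t\<close>, the averaging theory in
  \<open>t / \<epsilon>\<close>; local existence is applied to the rescaled field.\<close>

lemma C1_family_time_scale:
  assumes "C1_family U F F'"
  shows "C1_family U (\<lambda>t. F (t / r)) (\<lambda>t. F' (t / r))"
  unfolding C1_family_def
proof (intro conjI allI ballI)
  have "continuous_on (UNIV \<times> U) (\<lambda>p. F (fst p / r) (snd p))"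
    by (rule continuous_family_compose[OF C1_family_cont(1)[OF assms]])
       (auto intro!: continuous_intros simp: divide_inverse)
  then show "continuous_family U (\<lambda>t. F (t / r))"
    by (simp add: continuous_family_def case_prod_beta)
  have "continuous_on (UNIV \<times> U) (\<lambda>p. F' (fst p / r) (snd p))"
    by (rule continuous_family_compose[OF C1_family_cont(2)[OF assms]])
       (auto intro!: continuous_intros simp: divide_inverse)
  then show "continuous_family U (\<lambda>t. F' (t / r))"
    by (simp add: continuous_family_def case_prod_beta)
qed (rule C1_family_deriv[OF assms])

lemma symplectic_matrix_components:
  assumes "bij \<sigma>"
  shows "(symplectic_matrix \<sigma> *v x) $ \<sigma> (Inl k) = x $ \<sigma> (Inr k)"
    "(symplectic_matrix \<sigma> *v x) $ \<sigma> (Inr k) = - x $ \<sigma> (Inl k)"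
proof -
  have inj: "\<sigma> a = \<sigma> b \<longleftrightarrow> a = b" for a b
    using assms by (auto simp: bij_def inj_eq)
  have "symplectic_matrix \<sigma> $ \<sigma> (Inl k) $ j = (if j = \<sigma> (Inr k) then 1 else 0)" for j
  proof -
    have "symplectic_matrix \<sigma> $ \<sigma> (Inl k) $ j
        = (\<Sum>l\<in>UNIV. if k = l then (if j = \<sigma> (Inr l) then 1 else 0) else 0)"
      unfolding symplectic_matrix_def vec_lambda_beta by (rule sum.cong) (auto simp: inj)
    then show ?thesis by simp
  qed
  then have *: "symplectic_matrix \<sigma> $ \<sigma> (Inl k) $ j * x $ j = (if j = \<sigma> (Inr k) then x $ j else 0)" for j
    by simp
  show "(symplectic_matrix \<sigma> *v x) $ \<sigma> (Inl k) = x $ \<sigma> (Inr k)"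
    unfolding matrix_vector_mult_def by (simp add: *)
  have "symplectic_matrix \<sigma> $ \<sigma> (Inr k) $ j = (if j = \<sigma> (Inl k) then - 1 else 0)" for j
  proof -
    have "symplectic_matrix \<sigma> $ \<sigma> (Inr k) $ j
        = (\<Sum>l\<in>UNIV. if k = l then (if j = \<sigma> (Inl l) then - 1 else 0) else 0)"
      unfolding symplectic_matrix_def vec_lambda_beta by (rule sum.cong) (auto simp: inj)
    then show ?thesis by simp
  qed
  then have *: "symplectic_matrix \<sigma> $ \<sigma> (Inr k) $ j * x $ j = (if j = \<sigma> (Inl k) then - x $ j else 0)" for j
    by simp
  show "(symplectic_matrix \<sigma> *v x) $ \<sigma> (Inr k) = - x $ \<sigma> (Inl k)"
    unfolding matrix_vector_mult_def by (simp add: *)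
qed

lemma symplectic_matrix_square:
  assumes "bij \<sigma>"
  shows "symplectic_matrix \<sigma> *v (symplectic_matrix \<sigma> *v x) = - x"
proof -
  have "(symplectic_matrix \<sigma> *v (symplectic_matrix \<sigma> *v x)) $ \<sigma> s = - x $ \<sigma> s" for s
    by (cases s) (simp_all add: symplectic_matrix_components[OF assms])
  then show ?thesis
    using bij_is_surj[OF assms] by (metis surjD uminus_vec_def vec_eq_iff vector_uminus_component)
qed

lemma matrix_vector_mult_minus_left: "(- A) *v x = - (A *v x)" for A :: "real ^ 'n ^ 'm"
  by (simp add: matrix_vector_mult_def vec_eq_iff sum_negf)

lemma symplectic_matrix_invertible:
  fixes \<sigma> :: "'d::finite + 'd \<Rightarrow> 'm::finite"
  assumes "bij \<sigma>"
  shows "invertible (symplectic_matrix \<sigma>)"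
proof -
  let ?J = "symplectic_matrix \<sigma>"
  have "(?J ** (- ?J)) *v x = mat 1 *v x" "((- ?J) ** ?J) *v x = mat 1 *v x" for x
    using symplectic_matrix_square[OF assms, of x] symplectic_matrix_square[OF assms, of "- x"]
    by (simp_all add: matrix_vector_mult_minus_left linear_simps[OF matrix_vector_mul_bounded_linear] flip: matrix_vector_mul_assoc)
  then show ?thesis
    unfolding invertible_def matrix_eq by blast
qed

lemma symplectic_matrix_skew:
  "(symplectic_matrix \<sigma> *v x) \<bullet> y = - (x \<bullet> (symplectic_matrix \<sigma> *v y))"
proof -
  have skew: "symplectic_matrix \<sigma> $ i $ j = - symplectic_matrix \<sigma> $ j $ i" for i j
    unfolding symplectic_matrix_def by (auto simp: conj_commute simp flip: sum_negf intro!: sum.cong)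
  have "transpose (symplectic_matrix \<sigma>) $ i $ j = (- symplectic_matrix \<sigma>) $ i $ j" for i j
    using skew[of j i] by (simp only: transpose_def vec_lambda_beta vector_uminus_component)
  then have "transpose (symplectic_matrix \<sigma>) = - symplectic_matrix \<sigma>"
    by (simp only: vec_eq_iff simp_thms)
  then have "x v* symplectic_matrix \<sigma> = - (symplectic_matrix \<sigma> *v x)" for x
    by (metis matrix_vector_mult_minus_left transpose_matrix_vector)
  then show ?thesis
    using dot_lmul_matrix[of x "symplectic_matrix \<sigma>" y] by simp
qed

subsection \<open>The averaged field\<close>

locale averaged_field =
  fixes U :: "(real ^ 'm) set" and \<epsilon> :: real and f :: "real \<Rightarrow> real ^ 'm \<Rightarrow> real ^ 'm"
    and f' :: "real \<Rightarrow> real ^ 'm \<Rightarrow> (real ^ 'm) \<Rightarrow>\<^sub>L (real ^ 'm)"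
    and f'' :: "real \<Rightarrow> real ^ 'm \<Rightarrow> (real ^ 'm) \<Rightarrow>\<^sub>L ((real ^ 'm) \<Rightarrow>\<^sub>L (real ^ 'm))"
  assumes open_U: "open U"
    and f: "C1_family U f f'" and f': "C1_family U f' f''"
    and periodic: "u \<in> U \<Longrightarrow> f (\<theta> + 1) u = f \<theta> u"
begin

definition "g = primitive (\<lambda>\<theta> u. f \<theta> u - mean f u)"
definition "g' = primitive (\<lambda>\<theta> u. f' \<theta> u - mean f' u)"
definition "g'' = primitive (\<lambda>\<theta> u. f'' \<theta> u - mean f'' u)"
text \<open>The sum arises from subtracting the time derivative
  \<open>g' (f - mean f) + (f' - mean f') g\<close> of \<open>g' g\<close> from
  \<open>2 (f' g - g' (mean f))\<close>: what remains is
  \<open>(f' + mean f') g - g' (f + mean f)\<close>.\<close>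

definition "k \<theta> u = f \<theta> u + mean f u"
definition "k' \<theta> u = f' \<theta> u + mean f' u"
definition "k'' \<theta> u = f'' \<theta> u + mean f'' u"
definition "bracket \<theta> u = k' \<theta> u (g \<theta> u) - g' \<theta> u (k \<theta> u)"
definition "\<psi> \<theta> u = f \<theta> u - mean f u + (\<epsilon> / 2) *\<^sub>R (bracket \<theta> u - mean bracket u)"
definition "h = primitive \<psi>"

lemmas mean_f = C1_family_mean[OF open_U f] and mean_f' = C1_family_mean[OF open_U f']

lemma g: "C1_family U g g'" and g': "C1_family U g' g''"
  unfolding g_def g'_def g''_def
  by (intro C1_family_primitive[OF open_U] C1_family_diff f f' mean_f mean_f')+

lemma k: "C1_family U k k'" and k': "C1_family U k' k''"
  unfolding k_def[abs_def] k'_def[abs_def] k''_def[abs_def]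
  by (intro C1_family_add f f' mean_f mean_f')+

text \<open>The bracket contains \<open>k'\<close> and \<open>g'\<close>, so its differentiability
  is what the second derivative \<open>f''\<close> pays for.\<close>

lemma bracket_C1: "\<exists>D. C1_family U bracket D"
proof -
  obtain D1 D2 where "C1_family U (\<lambda>\<theta> u. k' \<theta> u (g \<theta> u)) D1" "C1_family U (\<lambda>\<theta> u. g' \<theta> u (k \<theta> u)) D2"
    using C1_family_apply[OF k' g] C1_family_apply[OF g' k] by blast
  from C1_family_diff[OF this] show ?thesis
    unfolding bracket_def[abs_def] by blast
qed

lemma psi_C1: "\<exists>D. C1_family U \<psi> D"
proof -
  obtain D where D: "C1_family U bracket D" using bracket_C1 by blast
  show ?thesis
    unfolding \<psi>_def[abs_def]
    using C1_family_add[OF C1_family_diff[OF f mean_f]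
        C1_family_scaleR[OF C1_family_diff[OF D C1_family_mean[OF open_U D]]]] by blast
qed

lemma g_period: "g 1 u = 0" and g'_period: "g' 1 u = 0" if "u \<in> U"
  unfolding g_def g'_def primitive_1
  by (fact mean_centred[OF C1_family_cont(1)[OF f] that] mean_centred[OF C1_family_cont(1)[OF f'] that])+

lemma g_periodic:
  assumes "u \<in> U"
  shows "g (\<theta> + 1) u = g \<theta> u"
  unfolding g_def
  by (rule primitive_periodic[OF C1_family_cont(1)[OF C1_family_diff[OF f mean_f]] assms])
     (use g_period[OF assms] in \<open>simp_all add: periodic assms g_def primitive_1\<close>)

lemma g_time_derivative:
  assumes "u \<in> U"
  shows "((\<lambda>\<theta>. g \<theta> u) has_vector_derivative f \<theta> u - mean f u) (at \<theta>)"
  unfolding g_def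
  using has_vector_derivative_primitive[of "\<lambda>\<theta> u. f \<theta> u - mean f u" u \<theta>]
    continuous_family_time[OF C1_family_cont(1)[OF C1_family_diff[OF f mean_f]] assms]
  by simp

lemma g'_time_derivative:
  assumes "u \<in> U"
  shows "((\<lambda>\<theta>. g' \<theta> u) has_vector_derivative f' \<theta> u - mean f' u) (at \<theta>)"
  unfolding g'_def
  using has_vector_derivative_primitive[of "\<lambda>\<theta> u. f' \<theta> u - mean f' u" u \<theta>]
    continuous_family_time[OF C1_family_cont(1)[OF C1_family_diff[OF f' mean_f']] assms]
  by simp

lemma g'_g_time_derivative:
  assumes "u \<in> U"
  shows "((\<lambda>\<theta>. g' \<theta> u (g \<theta> u)) has_vector_derivative
    g' \<theta> u (f \<theta> u - mean f u) + (f' \<theta> u - mean f' u) (g \<theta> u)) (at \<theta>)"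
  by (rule bounded_bilinear.has_vector_derivative[OF blinfun.bounded_bilinear_axioms
        g'_time_derivative[OF assms] g_time_derivative[OF assms]])

lemma f'_g_cont: "continuous_family U (\<lambda>\<theta> u. f' \<theta> u (g \<theta> u))"
  using C1_family_apply[OF f' g] C1_family_cont(1) by blast

text \<open>The total derivative of \<open>g' g\<close> integrates to zero over a period, which turns the averages
  occurring in the definition of the change of variable into the average of a Lie bracket.\<close>

lemma mean_bracket:
  assumes u: "u \<in> U"
  shows "mean bracket u = 2 *\<^sub>R (mean (\<lambda>\<theta> u. f' \<theta> u (g \<theta> u)) u - mean g' u (mean f u))"
proof -
  have 1: "((\<lambda>\<theta>. g' \<theta> u (f \<theta> u - mean f u) + (f' \<theta> u - mean f' u) (g \<theta> u)) has_integral
      g' 1 u (g 1 u) - g' 0 u (g 0 u)) {0..1}"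
    by (rule fundamental_theorem_of_calculus[OF zero_le_one
          has_vector_derivative_at_within[OF g'_g_time_derivative[OF u]]])
  have 2: "((\<lambda>\<theta>. f' \<theta> u (g \<theta> u)) has_integral mean (\<lambda>\<theta> u. f' \<theta> u (g \<theta> u)) u) {0..1}"
    by (rule continuous_family_has_mean[OF f'_g_cont u])
  have 3: "((\<lambda>\<theta>. g' \<theta> u (mean f u)) has_integral mean g' u (mean f u)) {0..1}"
    using has_integral_linear[OF continuous_family_has_mean[OF C1_family_cont(1)[OF g'] u]
        blinfun.bounded_linear_left[of "mean f u"]]
    by (simp add: o_def)
  have "((\<lambda>\<theta>. bracket \<theta> u) has_integral
     2 *\<^sub>R (mean (\<lambda>\<theta> u. f' \<theta> u (g \<theta> u)) u - mean g' u (mean f u)) - 0) {0..1}"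
  proof (rule has_integral_eq[rotated])
    show "((\<lambda>\<theta>. 2 *\<^sub>R (f' \<theta> u (g \<theta> u) - g' \<theta> u (mean f u)) -
        (g' \<theta> u (f \<theta> u - mean f u) + (f' \<theta> u - mean f' u) (g \<theta> u))) has_integral
        2 *\<^sub>R (mean (\<lambda>\<theta> u. f' \<theta> u (g \<theta> u)) u - mean g' u (mean f u)) - 0) {0..1}"
      using 1 g_period[OF u] g'_period[OF u]
      by (intro has_integral_diff has_integral_cmul 2 3) (simp add: g_def)
  qed (simp add: bracket_def k_def k'_def blinfun.bilinear_simps scaleR_2 algebra_simps)
  then show ?thesis
    unfolding mean_def[of bracket] by (simp add: integral_unique)
qed

lemma g_map_eq:
  assumes "u \<in> U"
  shows "g_map f \<theta> u = g \<theta> u"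
proof -
  have "average (\<lambda>\<sigma>. f \<sigma> u) = mean f u"
    using average_eq_mean[OF continuous_family_time[OF C1_family_cont(1)[OF f] assms], of u]
    by (simp add: mean_def)
  then have "g_map f \<theta> u = (LBINT \<tau>=0..\<theta>. f \<tau> u - mean f u)"
    by (simp add: g_map_def)
  also have "\<dots> = primitive (\<lambda>\<tau> _. f \<tau> u - mean f u) \<theta> u"
    by (rule LBINT_eq_primitive)
       (rule continuous_family_time[OF C1_family_cont(1)[OF C1_family_diff[OF f mean_f]] assms])
  finally show ?thesis by (simp add: g_def primitive_def)
qed

text \<open>Both sides vanish at time 0 and have time derivative \<open>\<psi>\<close>. The term
  with \<open>g' g\<close> contributes the product rule that completes the integrand of the formula
  to a centred bracket.\<close>

lemma h_map_eq:
  assumes u: "u \<in> U"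
  shows "h_map \<epsilon> f \<theta> u = h \<theta> u"
proof -
  \<comment> \<open>The Jacobian in the formula is that of \<open>g_map f\<close>, which is known to
    equal \<open>g\<close> on \<open>U\<close> only; openness of \<open>U\<close> transfers the
    derivative.\<close>
  have g_map: "C1_family U (g_map f) g'"
    by (rule C1_family_cong[OF open_U g]) (simp_all add: g_map_eq)
  have avg_f: "average (\<lambda>\<sigma>. f \<sigma> u) = mean f u"
    using average_eq_mean[OF continuous_family_time[OF C1_family_cont(1)[OF f] u], of u]
    by (simp add: mean_def)
  define X where "X = mean (\<lambda>\<theta> u. f' \<theta> u (g \<theta> u)) u"
  have avg_f'g: "average (\<lambda>\<sigma>. f' \<sigma> u (g \<sigma> u)) = X"
    using average_eq_mean[OF continuous_family_time[OF f'_g_cont u], of u]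
    by (simp add: mean_def X_def)
  define \<phi> where "\<phi> \<tau> = f' \<tau> u (g \<tau> u) - X - (g' \<tau> u - mean g' u) (mean f u)" for \<tau>
  have \<phi>: "continuous_on UNIV \<phi>"
    unfolding \<phi>_def[abs_def]
    by (intro continuous_intros continuous_family_time[OF f'_g_cont u]
        continuous_family_time[OF C1_family_cont(1)[OF g'] u])
  define Q where "Q \<theta> = g \<theta> u + \<epsilon> *\<^sub>R primitive (\<lambda>\<tau> _. \<phi> \<tau>) \<theta> u - (\<epsilon> / 2) *\<^sub>R g' \<theta> u (g \<theta> u)" for \<theta>
  have "h_map \<epsilon> f \<theta> u = g \<theta> u + \<epsilon> *\<^sub>R (LBINT \<tau>=0..\<theta>. \<phi> \<tau>) - (\<epsilon> / 2) *\<^sub>R g' \<theta> u (g \<theta> u)"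
    unfolding h_map_def Let_def \<phi>_def
    by (simp add: g_map_eq[OF u] jacobian_C1_family(2)[OF f u] jacobian_C1_family(2)[OF g_map u]
        average_jacobian[OF g_map u] avg_f avg_f'g matrix_vector_mult_diff_rdistrib blinfun.diff_left)
  then have "h_map \<epsilon> f \<theta> u = Q \<theta>"
    unfolding Q_def LBINT_eq_primitive[OF \<phi>, of \<theta> u] .
  moreover have "h \<theta> u = Q \<theta>"
    unfolding h_def
  proof (rule primitive_eqI)
    show "Q 0 = 0" by (simp add: Q_def g_def g'_def)
    fix \<tau>
    have "(Q has_vector_derivative f \<tau> u - mean f u + \<epsilon> *\<^sub>R \<phi> \<tau> -
        (\<epsilon> / 2) *\<^sub>R (g' \<tau> u (f \<tau> u - mean f u) + (f' \<tau> u - mean f' u) (g \<tau> u))) (at \<tau>)"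
      unfolding Q_def[abs_def]
      by (intro has_vector_derivative_diff has_vector_derivative_add g_time_derivative[OF u]
          bounded_linear.has_vector_derivative[OF bounded_linear_scaleR_right]
          has_vector_derivative_primitive[of "\<lambda>\<tau> _. \<phi> \<tau>", OF \<phi>] g'_g_time_derivative[OF u])
    also have "\<epsilon> *\<^sub>R \<phi> \<tau> = (\<epsilon> / 2) *\<^sub>R (2 *\<^sub>R \<phi> \<tau>)"
      by simp
    also have "f \<tau> u - mean f u + (\<epsilon> / 2) *\<^sub>R (2 *\<^sub>R \<phi> \<tau>) -
        (\<epsilon> / 2) *\<^sub>R (g' \<tau> u (f \<tau> u - mean f u) + (f' \<tau> u - mean f' u) (g \<tau> u)) =
        f \<tau> u - mean f u + (\<epsilon> / 2) *\<^sub>R (2 *\<^sub>R \<phi> \<tau> -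
          (g' \<tau> u (f \<tau> u - mean f u) + (f' \<tau> u - mean f' u) (g \<tau> u)))"
      by (simp only: scaleR_diff_right add_diff_eq)
    \<comment> \<open>The constants in \<open>2 *\<^sub>R \<phi> \<tau>\<close> are exactly minus
      the mean of the bracket, by \<open>mean_bracket\<close>.\<close>
    also have "2 *\<^sub>R \<phi> \<tau> - (g' \<tau> u (f \<tau> u - mean f u) + (f' \<tau> u - mean f' u) (g \<tau> u)) =
        bracket \<tau> u - mean bracket u"
      unfolding mean_bracket[OF u] \<phi>_def bracket_def k_def k'_def X_def[symmetric]
      by (simp add: blinfun.bilinear_simps scaleR_2 algebra_simps)
    finally show "(Q has_vector_derivative \<psi> \<tau> u) (at \<tau>)"
      by (simp add: \<psi>_def)
  qed
  ultimately show ?thesis by simp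
qed

text \<open>Orthogonality to the affine field \<open>S w + b\<close> passes from \<open>f\<close> to
  \<open>mean f\<close>, \<open>g\<close> and \<open>k\<close> by linearity and to the bracket by
  symmetry of \<open>S\<close>. It is assumed on all of \<open>U\<close>, since the bracket step
  differentiates it.\<close>

lemma h_orthogonal:
  assumes u: "u \<in> U" and S: "bounded_linear S" "\<And>x y. S x \<bullet> y = x \<bullet> S y"
    and orth: "\<And>\<theta> w. w \<in> U \<Longrightarrow> (S w + b) \<bullet> f \<theta> w = 0"
  shows "(S u + b) \<bullet> h \<theta> u = 0"
proof -
  have mean: "(S w + b) \<bullet> mean f w = 0" if "w \<in> U" for w
    by (rule inner_mean_eq_0[OF C1_family_cont(1)[OF f] that orth[OF that]])
  have g_orth: "(S w + b) \<bullet> g \<theta> w = 0" if "w \<in> U" for \<theta> w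
    unfolding g_def
    by (rule inner_primitive_eq_0[OF C1_family_cont(1)[OF C1_family_diff[OF f mean_f]] that])
       (simp add: inner_diff_right orth mean that)
  have k_orth: "(S w + b) \<bullet> k \<theta> w = 0" if "w \<in> U" for \<theta> w
    by (simp add: k_def inner_add_right orth mean that)
  have br: "(S u + b) \<bullet> bracket \<theta> u = 0" for \<theta>
    unfolding bracket_def
    by (rule bracket_tangent[OF open_U u S C1_family_deriv[OF k u] k_orth C1_family_deriv[OF g u] g_orth])
  obtain D where D: "C1_family U bracket D" using bracket_C1 by blast
  have "(S u + b) \<bullet> mean bracket u = 0"
    by (rule inner_mean_eq_0[OF C1_family_cont(1)[OF D] u br])
  then have "(S u + b) \<bullet> \<psi> \<theta> u = 0" for \<theta>
    by (simp add: \<psi>_def inner_add_right inner_diff_right br orth mean u)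
  moreover obtain D' where D': "C1_family U \<psi> D'" using psi_C1 by blast
  ultimately show ?thesis
    unfolding h_def using inner_primitive_eq_0[OF C1_family_cont(1)[OF D'] u] by blast
qed

text \<open>\<open>\<eta>\<close> repeats the formula for \<open>\<psi>\<close> with each field
  replaced by its potential. Its periodicity relies on that of \<open>g\<close>, a primitive of a
  centred periodic family.\<close>

lemma psi_hamiltonian:
  assumes J: "\<And>x y. (J *v x) \<bullet> y = - (x \<bullet> (J *v y))"
    and H: "hamiltonian_family J U f H" "\<And>\<theta> u. u \<in> U \<Longrightarrow> H (\<theta> + 1) u = H \<theta> u"
  shows "\<exists>\<eta>. hamiltonian_family J U \<psi> \<eta> \<and> (\<forall>\<theta>. \<forall>u\<in>U. \<eta> (\<theta> + 1) u = \<eta> \<theta> u)"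
proof -
  note mean_H = hamiltonian_family_mean[OF open_U H(1) C1_family_cont(1)[OF f]]
  have 1: "hamiltonian_family J U g (primitive (\<lambda>\<theta> u. H \<theta> u - mean H u))"
    unfolding g_def
    by (rule hamiltonian_family_primitive[OF open_U hamiltonian_family_diff[OF H(1) mean_H]
          C1_family_cont(1)[OF C1_family_diff[OF f mean_f]]])
  have 2: "hamiltonian_family J U k (\<lambda>\<theta> u. H \<theta> u + mean H u)"
    unfolding k_def[abs_def] by (rule hamiltonian_family_add[OF H(1) mean_H])
  define P where "P \<theta> u = (J *v k \<theta> u) \<bullet> g \<theta> u" for \<theta> u
  have 3: "hamiltonian_family J U bracket P"
    unfolding bracket_def[abs_def] P_def[abs_def]
    by (rule hamiltonian_family_bracket[OF open_U J 2 k 1 g])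
  obtain D where D: "C1_family U bracket D" using bracket_C1 by blast
  define \<eta> where "\<eta> \<theta> u = H \<theta> u - mean H u + (\<epsilon> / 2) *\<^sub>R (P \<theta> u - mean P u)" for \<theta> u
  have "hamiltonian_family J U \<psi> \<eta>"
    unfolding \<psi>_def[abs_def] \<eta>_def[abs_def]
    by (intro hamiltonian_family_add hamiltonian_family_diff hamiltonian_family_scaleR H(1) mean_H 3
        hamiltonian_family_mean[OF open_U 3 C1_family_cont(1)[OF D]])
  moreover have "\<eta> (\<theta> + 1) u = \<eta> \<theta> u" if "u \<in> U" for \<theta> u
    by (simp add: \<eta>_def P_def k_def g_periodic periodic H(2) that)
  ultimately show ?thesis by blast
qed

end

subsection \<open>The midpoint change of variable\<close>

locale midpoint_change = averaged_field U \<epsilon> f f' f''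
  for U :: "(real ^ 'm) set" and \<epsilon> f f' f'' +
  fixes V :: "(real ^ 'm) set" and \<Phi> :: "real \<Rightarrow> real ^ 'm \<Rightarrow> real ^ 'm"
  assumes \<epsilon>: "\<epsilon> \<noteq> 0" and open_V: "open V"
    and \<Phi>: "midpoint_change_of_variable \<epsilon> U f V \<Phi>"
begin

definition "mid \<theta> v = midpoint (\<Phi> \<theta> v) v"

lemma Phi_in_U: "v \<in> V \<Longrightarrow> \<Phi> \<theta> v \<in> U"
  and mid_in_U: "v \<in> V \<Longrightarrow> mid \<theta> v \<in> U"
  and Phi_periodic: "v \<in> V \<Longrightarrow> \<Phi> (\<theta> + 1) v = \<Phi> \<theta> v"
  and Phi_invertible: "v \<in> V \<Longrightarrow> invertible (jacobian (\<Phi> \<theta>) (at v))"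
  and Phi_differentiable: "(\<lambda>(\<theta>, v). \<Phi> \<theta> v) differentiable_on (UNIV \<times> V)"
  using \<Phi> unfolding midpoint_change_of_variable_def mid_def by blast+

lemma Phi_midpoint:
  assumes "v \<in> V"
  shows "\<Phi> \<theta> v = v + \<epsilon> *\<^sub>R h \<theta> (mid \<theta> v)"
proof -
  have "\<Phi> \<theta> v = v + \<epsilon> *\<^sub>R h_map \<epsilon> f \<theta> (mid \<theta> v)"
    using \<Phi> assms unfolding midpoint_change_of_variable_def mid_def by blast
  then show ?thesis
    by (simp only: h_map_eq[OF mid_in_U[OF assms]])
qed

lemma continuous_on_Phi: "continuous_on (UNIV \<times> V) (\<lambda>p. \<Phi> (fst p) (snd p))"
  using differentiable_imp_continuous_on[OF Phi_differentiable] by (simp add: case_prod_beta')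

lemma continuous_on_mid: "continuous_on (UNIV \<times> V) (\<lambda>p. mid (fst p) (snd p))"
  unfolding mid_def midpoint_def by (intro continuous_intros continuous_on_Phi)

abbreviation "\<Phi>\<^sub>u \<theta> v \<equiv> jacobian (\<Phi> \<theta>) (at v)"
abbreviation "\<Phi>\<^sub>t \<theta> v \<equiv> vector_derivative (\<lambda>\<sigma>. \<Phi> \<sigma> v) (at \<theta>)"

text \<open>The total derivative is split into the two partial derivatives in which
  \<open>pullback_field\<close> is expressed, by restricting it to vectors of the form
  \<open>(0, y)\<close> and \<open>(s, 0)\<close>.\<close>

lemma Phi_has_derivative:
  assumes v: "v \<in> V"
  shows "((\<lambda>p. \<Phi> (fst p) (snd p)) has_derivative
    (\<lambda>p. fst p *\<^sub>R \<Phi>\<^sub>t \<theta> v + \<Phi>\<^sub>u \<theta> v *v snd p)) (at (\<theta>, v))"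
proof -
  have "open (UNIV \<times> V)" "(\<theta>, v) \<in> UNIV \<times> V" using open_V v by (simp_all add: open_Times)
  note at = at_within_open[OF this(2,1)]
  have "(\<lambda>p. \<Phi> (fst p) (snd p)) differentiable (at (\<theta>, v) within UNIV \<times> V)"
    using Phi_differentiable v by (simp add: differentiable_on_def case_prod_beta')
  then obtain D where D: "((\<lambda>p. \<Phi> (fst p) (snd p)) has_derivative D) (at (\<theta>, v))"
    unfolding at by (auto simp: differentiable_def)
  interpret D: bounded_linear D by (rule has_derivative_bounded_linear[OF D])
  have 1: "(Pair \<theta> has_derivative (\<lambda>y. (0, y))) (at v)"
    by (intro has_derivative_Pair has_derivative_const has_derivative_ident)
  have "(\<Phi> \<theta> has_derivative (\<lambda>y. D (0, y))) (at v)"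
    using has_derivative_compose[OF 1 D] by simp
  moreover from this have "(\<Phi> \<theta> has_derivative (\<lambda>y. \<Phi>\<^sub>u \<theta> v *v y)) (at v)"
    unfolding jacobian_works[symmetric] by (rule differentiableI)
  ultimately have "(\<lambda>y. D (0, y)) = (\<lambda>y. \<Phi>\<^sub>u \<theta> v *v y)"
    by (rule has_derivative_unique)
  then have du: "\<Phi>\<^sub>u \<theta> v *v y = D (0, y)" for y
    by metis
  have 2: "((\<lambda>\<sigma>. (\<sigma>, v)) has_derivative (\<lambda>s. (s, 0))) (at \<theta>)"
    by (intro has_derivative_Pair has_derivative_const has_derivative_ident)
  have "((\<lambda>\<sigma>. \<Phi> \<sigma> v) has_derivative (\<lambda>s. D (s, 0))) (at \<theta>)"
    using has_derivative_compose[OF 2 D] by simp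
  moreover have "(\<lambda>s. D (s, 0)) = (\<lambda>s. s *\<^sub>R D (1, 0))"
  proof
    show "D (s, 0) = s *\<^sub>R D (1, 0)" for s
      using D.scaleR[of s "(1, 0)"] by simp
  qed
  ultimately have "((\<lambda>\<sigma>. \<Phi> \<sigma> v) has_vector_derivative D (1, 0)) (at \<theta>)"
    by (simp add: has_vector_derivative_def)
  then have dt: "\<Phi>\<^sub>t \<theta> v = D (1, 0)"
    by (rule vector_derivative_at)
  have "D p = fst p *\<^sub>R \<Phi>\<^sub>t \<theta> v + \<Phi>\<^sub>u \<theta> v *v snd p" for p
  proof -
    have "D p = D (fst p *\<^sub>R (1, 0) + (0, snd p))" by simp
    also have "\<dots> = fst p *\<^sub>R D (1, 0) + D (0, snd p)" by (simp only: D.add D.scaleR)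
    finally show ?thesis by (simp only: du dt)
  qed
  then show ?thesis using D by presburger
qed

lemma mid_has_derivative:
  assumes v: "v \<in> V"
  shows "((\<lambda>p. mid (fst p) (snd p)) has_derivative
    (\<lambda>p. (1/2) *\<^sub>R (fst p *\<^sub>R \<Phi>\<^sub>t \<theta> v + \<Phi>\<^sub>u \<theta> v *v snd p + snd p))) (at (\<theta>, v))"
proof -
  have "((\<lambda>p. (1/2) *\<^sub>R (\<Phi> (fst p) (snd p) + snd p)) has_derivative
    (\<lambda>p. (1/2) *\<^sub>R (fst p *\<^sub>R \<Phi>\<^sub>t \<theta> v + \<Phi>\<^sub>u \<theta> v *v snd p + snd p))) (at (\<theta>, v))"
    by (intro has_derivative_scaleR_right has_derivative_add Phi_has_derivative[OF v]
        has_derivative_snd has_derivative_ident)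
  then show ?thesis by (simp add: mid_def midpoint_def)
qed

lemma Phi_slice_has_derivative:
  assumes v: "v \<in> V"
  shows "(\<Phi> \<theta> has_derivative (\<lambda>y. \<Phi>\<^sub>u \<theta> v *v y)) (at v)"
    "(mid \<theta> has_derivative (\<lambda>y. (1/2) *\<^sub>R (\<Phi>\<^sub>u \<theta> v *v y + y))) (at v)"
proof -
  have 1: "(Pair \<theta> has_derivative (\<lambda>y. (0, y))) (at v)"
    by (intro has_derivative_Pair has_derivative_const has_derivative_ident)
  show "(\<Phi> \<theta> has_derivative (\<lambda>y. \<Phi>\<^sub>u \<theta> v *v y)) (at v)"
    "(mid \<theta> has_derivative (\<lambda>y. (1/2) *\<^sub>R (\<Phi>\<^sub>u \<theta> v *v y + y))) (at v)"
    using has_derivative_compose[OF 1 Phi_has_derivative[OF v]]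
      has_derivative_compose[OF 1 mid_has_derivative[OF v]] by simp_all
qed

text \<open>\<open>h\<close> is differentiable in time as a primitive of the continuous
  \<open>\<psi>\<close>, and its derivative in \<open>u\<close> is jointly continuous. This suffices
  for a total derivative; the ball again provides convexity.\<close>

lemma h_has_derivative:
  assumes \<psi>': "C1_family U \<psi> \<psi>'" and u: "u \<in> U"
  shows "((\<lambda>p. h (fst p) (snd p)) has_derivative
    (\<lambda>p. fst p *\<^sub>R \<psi> \<theta> u + primitive \<psi>' \<theta> u (snd p))) (at (\<theta>, u))"
proof -
  have h: "C1_family U h (primitive \<psi>')"
    unfolding h_def by (rule C1_family_primitive[OF open_U \<psi>'])
  obtain r where r: "r > 0" "ball u r \<subseteq> U"
    using open_U u openE by blast
  have op: "open ((UNIV :: real set) \<times> ball u r)" by (simp add: open_Times)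
  have "((\<lambda>(\<theta>, u). h \<theta> u) has_derivative (\<lambda>(s, y). s *\<^sub>R \<psi> \<theta> u + primitive \<psi>' \<theta> u y))
      (at (\<theta>, u) within UNIV \<times> ball u r)"
  proof (rule has_derivative_partialsI)
    show "((\<lambda>\<theta>. h \<theta> u) has_derivative (\<lambda>s. s *\<^sub>R \<psi> \<theta> u)) (at \<theta> within UNIV)"
      using has_vector_derivative_primitive[of \<psi> u, OF continuous_family_time[OF C1_family_cont(1)[OF \<psi>'] u]]
      by (simp add: h_def has_vector_derivative_def)
    show "(h \<theta> has_derivative primitive \<psi>' \<theta> w) (at w within ball u r)"
      if "w \<in> ball u r" for \<theta> w
      using has_derivative_at_withinI[OF C1_family_deriv[OF h]] that r(2) by blast
    have "continuous_on (UNIV \<times> ball u r) (\<lambda>(\<theta>, u). primitive \<psi>' \<theta> u)"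
      using C1_family_cont(2)[OF h] r(2) unfolding continuous_family_def
      by (meson continuous_on_subset Sigma_mono subset_refl)
    then show "continuous (at (\<theta>, u) within UNIV \<times> ball u r) (\<lambda>(\<theta>, u). primitive \<psi>' \<theta> u)"
      using r(1) by (simp add: continuous_on_eq_continuous_within)
  qed (use r in auto)
  then show ?thesis
    using r(1) by (simp add: at_within_open[OF _ op] case_prod_beta')
qed

text \<open>Both sides of the midpoint relation are differentiated in time and space together, and
  uniqueness of the derivative gives linear relations for the two partials. \<open>A\<close> is the
  derivative of \<open>h\<close> at the midpoint.\<close>

lemma linearised_midpoint:
  fixes \<theta> :: real
  assumes \<psi>': "C1_family U \<psi> \<psi>'" and v: "v \<in> V"
  defines "A \<equiv> primitive \<psi>' \<theta> (mid \<theta> v)"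
  shows "\<Phi>\<^sub>u \<theta> v *v y = y + \<epsilon> *\<^sub>R A ((1/2) *\<^sub>R (\<Phi>\<^sub>u \<theta> v *v y + y))"
    "\<Phi>\<^sub>t \<theta> v = \<epsilon> *\<^sub>R (\<psi> \<theta> (mid \<theta> v) + A ((1/2) *\<^sub>R \<Phi>\<^sub>t \<theta> v))"
proof -
  define M where "M p = (1/2) *\<^sub>R (fst p *\<^sub>R \<Phi>\<^sub>t \<theta> v + \<Phi>\<^sub>u \<theta> v *v snd p + snd p)" for p
  have M: "((\<lambda>p. (fst p, mid (fst p) (snd p))) has_derivative (\<lambda>p. (fst p, M p))) (at (\<theta>, v))"
    unfolding M_def
    by (intro has_derivative_Pair has_derivative_fst has_derivative_ident mid_has_derivative[OF v])
  have "((\<lambda>p. h (fst p) (mid (fst p) (snd p))) has_derivative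
      (\<lambda>p. fst p *\<^sub>R \<psi> \<theta> (mid \<theta> v) + A (M p))) (at (\<theta>, v))"
    using has_derivative_compose[OF M, of "\<lambda>p. h (fst p) (snd p)"
        "\<lambda>p. fst p *\<^sub>R \<psi> \<theta> (mid \<theta> v) + A (snd p)"]
      h_has_derivative[OF \<psi>' mid_in_U[OF v], of \<theta> \<theta>] by (simp add: A_def)
  then have 1: "((\<lambda>p. snd p + \<epsilon> *\<^sub>R h (fst p) (mid (fst p) (snd p))) has_derivative
      (\<lambda>p. snd p + \<epsilon> *\<^sub>R (fst p *\<^sub>R \<psi> \<theta> (mid \<theta> v) + A (M p)))) (at (\<theta>, v))"
    by (intro has_derivative_add has_derivative_snd has_derivative_ident has_derivative_scaleR_right)
  have "open ((UNIV :: real set) \<times> V)" "(\<theta>, v) \<in> UNIV \<times> V"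
    using open_V v by (auto simp: open_Times)
  from has_derivative_transform_within_open[OF 1 this, of "\<lambda>p. \<Phi> (fst p) (snd p)"]
  have "((\<lambda>p. \<Phi> (fst p) (snd p)) has_derivative
      (\<lambda>p. snd p + \<epsilon> *\<^sub>R (fst p *\<^sub>R \<psi> \<theta> (mid \<theta> v) + A (M p)))) (at (\<theta>, v))"
    using Phi_midpoint by (simp add: mem_Times_iff)
  from has_derivative_unique[OF Phi_has_derivative[OF v] this]
  have eq: "fst p *\<^sub>R \<Phi>\<^sub>t \<theta> v + \<Phi>\<^sub>u \<theta> v *v snd p
      = snd p + \<epsilon> *\<^sub>R (fst p *\<^sub>R \<psi> \<theta> (mid \<theta> v) + A (M p))" for p
    by meson
  show "\<Phi>\<^sub>u \<theta> v *v y = y + \<epsilon> *\<^sub>R A ((1/2) *\<^sub>R (\<Phi>\<^sub>u \<theta> v *v y + y))"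
    using eq[of "(0, y)"] by (simp add: M_def)
  show "\<Phi>\<^sub>t \<theta> v = \<epsilon> *\<^sub>R (\<psi> \<theta> (mid \<theta> v) + A ((1/2) *\<^sub>R \<Phi>\<^sub>t \<theta> v))"
    using eq[of "(1, 0)"] by (simp add: M_def)
qed

section \<open>Conservation of quadratic first integrals by the pullback\<close>

lemma pullback_field_eq:
  assumes "v \<in> V"
  shows "\<Phi>\<^sub>u \<theta> v *v pullback_field \<epsilon> f \<Phi> \<theta> v = f \<theta> (\<Phi> \<theta> v) - (1 / \<epsilon>) *\<^sub>R \<Phi>\<^sub>t \<theta> v"
  unfolding pullback_field_def by (rule matrix_inv_mult(1)[OF Phi_invertible[OF assms]])

text \<open>The chain rule adds \<open>\<Phi>\<^sub>t\<close> divided by \<open>\<epsilon>\<close>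
  to \<open>\<Phi>\<^sub>u\<close> applied to the pullback field; the latter is defined so that the
  sum is \<open>f\<close>.\<close>

lemma pullback_solution:
  assumes "ode_solution (\<lambda>t. pullback_field \<epsilon> f \<Phi> (t / \<epsilon>)) V T v"
  shows "ode_solution (\<lambda>t. f (t / \<epsilon>)) U T (\<lambda>t. \<Phi> (t / \<epsilon>) (v t))"
  unfolding ode_solution_def
proof (intro conjI ballI)
  show "is_interval T" using assms by (simp add: ode_solution_def)
  fix t assume t: "t \<in> T"
  then have v: "v t \<in> V"
    and dv: "(v has_vector_derivative pullback_field \<epsilon> f \<Phi> (t / \<epsilon>) (v t)) (at t within T)"
    using assms by (auto simp: ode_solution_def)
  show "\<Phi> (t / \<epsilon>) (v t) \<in> U" using Phi_in_U[OF v] .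
  let ?w = "pullback_field \<epsilon> f \<Phi> (t / \<epsilon>) (v t)"
  have "((\<lambda>t. t / \<epsilon>) has_derivative (\<lambda>s. s / \<epsilon>)) (at t within T)"
    by (rule bounded_linear.has_derivative[OF bounded_linear_divide has_derivative_ident])
  then have 1: "((\<lambda>t. (t / \<epsilon>, v t)) has_derivative (\<lambda>s. (s / \<epsilon>, s *\<^sub>R ?w))) (at t within T)"
    using dv unfolding has_vector_derivative_def by (rule has_derivative_Pair)
  have "((\<lambda>t. \<Phi> (t / \<epsilon>) (v t)) has_derivative
      (\<lambda>s. (s / \<epsilon>) *\<^sub>R \<Phi>\<^sub>t (t / \<epsilon>) (v t) + \<Phi>\<^sub>u (t / \<epsilon>) (v t) *v (s *\<^sub>R ?w))) (at t within T)"
    using has_derivative_compose[OF 1 Phi_has_derivative[OF v]] by simp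
  moreover have "(s / \<epsilon>) *\<^sub>R \<Phi>\<^sub>t (t / \<epsilon>) (v t) + \<Phi>\<^sub>u (t / \<epsilon>) (v t) *v (s *\<^sub>R ?w)
      = s *\<^sub>R f (t / \<epsilon>) (\<Phi> (t / \<epsilon>) (v t))" for s
    by (simp add: matrix_vector_mult_scaleR pullback_field_eq[OF v] scaleR_diff_right)
  ultimately show "((\<lambda>t. \<Phi> (t / \<epsilon>) (v t)) has_vector_derivative f (t / \<epsilon>) (\<Phi> (t / \<epsilon>) (v t))) (at t within T)"
    by (simp add: has_vector_derivative_def)
qed

lemma quadratic_integral_Phi:
  assumes I: "\<And>u. I u = u \<bullet> (C *v u) + b \<bullet> u + c" and "first_integral (\<lambda>t. f (t / \<epsilon>)) U I"
    and v: "v \<in> V"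
  shows "I (\<Phi> \<theta> v) = I v"
proof -
  define S where "S u = (C + transpose C) *v u" for u
  have S: "bounded_linear S" unfolding S_def[abs_def] by (rule matrix_vector_mul_bounded_linear)
  have S_sym: "S x \<bullet> y = x \<bullet> S y" for x y
  proof -
    have "x \<bullet> (y v* C) = (C *v x) \<bullet> y"
      by (metis dot_lmul_matrix inner_commute)
    then show ?thesis
      by (simp add: S_def matrix_vector_mult_add_rdistrib inner_add_left inner_add_right dot_lmul_matrix)
  qed
  have I_eq: "I = (\<lambda>u. u \<bullet> (C *v u) + b \<bullet> u + c)" by (simp add: fun_eq_iff I)
  \<comment> \<open>The tangency is read off at the time \<open>\<theta> * \<epsilon>\<close>, whose
    rescaled value is \<open>\<theta>\<close>.\<close>
  have orth: "(S w + b) \<bullet> f \<theta> w = 0" if "w \<in> U" for \<theta> w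
    using first_integral_imp_orthogonal[OF open_U that C1_family_time_scale[OF f] assms(2)
        quadratic_has_derivative[of C b c w, folded I_eq], of "\<theta> * \<epsilon>"] \<epsilon>
    by (simp add: S_def)
  have "I (\<Phi> \<theta> v) - I v = (S (mid \<theta> v) + b) \<bullet> (\<Phi> \<theta> v - v)"
    unfolding I S_def mid_def by (rule quadratic_diff_midpoint)
  also have "\<Phi> \<theta> v - v = \<epsilon> *\<^sub>R h \<theta> (mid \<theta> v)"
    using Phi_midpoint[OF v, of \<theta>] by (simp add: algebra_simps)
  also have "(S (mid \<theta> v) + b) \<bullet> (\<epsilon> *\<^sub>R h \<theta> (mid \<theta> v)) = 0"
    using h_orthogonal[OF mid_in_U[OF v] S S_sym orth] by simp
  finally show ?thesis by simp
qed

lemma pullback_quadratic_integral: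
  assumes "quadratic_function I" and I: "first_integral (\<lambda>t. f (t / \<epsilon>)) U I"
  shows "first_integral (\<lambda>t. pullback_field \<epsilon> f \<Phi> (t / \<epsilon>)) V I"
  unfolding first_integral_def
proof (intro allI impI ballI)
  fix T v s t
  assume v: "ode_solution (\<lambda>t. pullback_field \<epsilon> f \<Phi> (t / \<epsilon>)) V T v" and st: "s \<in> T" "t \<in> T"
  obtain C b c where Q: "\<And>u. I u = u \<bullet> (C *v u) + b \<bullet> u + c"
    using assms(1) unfolding quadratic_function_def by blast
  have "I (\<Phi> (r / \<epsilon>) (v r)) = I (v r)" if "r \<in> T" for r
    using v that by (intro quadratic_integral_Phi[OF Q I]) (simp add: ode_solution_def)
  moreover have "I (\<Phi> (t / \<epsilon>) (v t)) = I (\<Phi> (s / \<epsilon>) (v s))"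
    using I pullback_solution[OF v] st unfolding first_integral_def by fast
  ultimately show "I (v t) = I (v s)" using st by simp
qed

section \<open>Hamiltonian structure of the pullback\<close>

text \<open>With \<open>\<omega> (x, y) = x \<bullet> J y\<close>, the derivative \<open>\<Phi>\<^sub>u\<close> preserves \<open>\<omega>\<close> and \<open>\<omega> (\<Phi>\<^sub>u y, \<Phi>\<^sub>t)\<close> is \<open>\<epsilon>\<close> times the
  derivative of the potential of \<open>\<psi>\<close> along the derivative of the midpoint. Hence the potential of the
  pullback is \<open>H\<close> at \<open>\<Phi> v\<close> minus the potential of \<open>\<psi>\<close> at the midpoint.\<close>

lemma pullback_gradient:
  assumes J: "\<And>x y. (J *v x) \<bullet> y = - (x \<bullet> (J *v y))"
    and \<psi>': "C1_family U \<psi> \<psi>'" and \<eta>: "hamiltonian_family J U \<psi> \<eta>" and v: "v \<in> V"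
  shows "(J *v f \<theta> (\<Phi> \<theta> v)) \<bullet> (\<Phi>\<^sub>u \<theta> v *v y)
      - (J *v \<psi> \<theta> (mid \<theta> v)) \<bullet> ((1/2) *\<^sub>R (\<Phi>\<^sub>u \<theta> v *v y + y))
    = y \<bullet> (J *v pullback_field \<epsilon> f \<Phi> \<theta> v)"
proof -
  define A where "A x = (\<epsilon> / 2) *\<^sub>R primitive \<psi>' \<theta> (mid \<theta> v) x" for x
  define \<omega> where "\<omega> x y = x \<bullet> (J *v y)" for x y
  note J_lin = linear_simps[OF matrix_vector_mul_bounded_linear[of J]]
  have bil: "\<omega> (x + x') y = \<omega> x y + \<omega> x' y" "\<omega> x (y + y') = \<omega> x y + \<omega> x y'"
    "\<omega> (x - x') y = \<omega> x y - \<omega> x' y" "\<omega> x (y - y') = \<omega> x y - \<omega> x y'"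
    "\<omega> (r *\<^sub>R x) y = r * \<omega> x y" "\<omega> x (r *\<^sub>R y) = r * \<omega> x y" for x x' y y' r
    by (simp_all add: \<omega>_def J_lin inner_add_left inner_add_right inner_diff_left inner_diff_right)
  have \<omega>_flip: "(J *v x) \<bullet> y = - \<omega> x y" "(J *v x) \<bullet> y = \<omega> y x" for x y
    using J[of x y] by (simp_all add: \<omega>_def inner_commute)
  \<comment> \<open>\<open>A\<close> is half of \<open>\<epsilon>\<close> times the derivative of
    \<open>h\<close>, which is Hamiltonian with potential \<open>primitive \<eta>\<close>. Symmetry
    of that Hessian says that \<open>A\<close> is skew for \<open>\<omega>\<close>.\<close>
  have A: "\<omega> (A x) y = - \<omega> x (A y)" for x y
  proof -
    have "hamiltonian_family J U h (primitive \<eta>)" "C1_family U h (primitive \<psi>')"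
      unfolding h_def
      by (rule hamiltonian_family_primitive[OF open_U \<eta> C1_family_cont(1)[OF \<psi>']]
          C1_family_primitive[OF open_U \<psi>'])+
    from hamiltonian_family_symmetric[OF open_U mid_in_U[OF v] this, of \<theta> \<theta> x y]
    have "\<omega> y (primitive \<psi>' \<theta> (mid \<theta> v) x) = \<omega> x (primitive \<psi>' \<theta> (mid \<theta> v) y)"
      by (simp only: \<omega>_flip(2))
    moreover have "\<omega> (A x) y = - \<omega> y (A x)"
      using \<omega>_flip[of "A x" y] by simp
    ultimately show ?thesis by (simp add: A_def bil)
  qed
  define P where "P y = (1/2) *\<^sub>R (\<Phi>\<^sub>u \<theta> v *v y + y)" for y
  have lin: "\<Phi>\<^sub>u \<theta> v *v y = y + 2 *\<^sub>R A (P y)" for y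
    using linearised_midpoint(1)[OF \<psi>' v, of \<theta> y] by (simp add: A_def P_def)
  \<comment> \<open>With \<open>P\<close> the derivative of the midpoint, this reads
    \<open>\<Phi>\<^sub>u = (1 + A) P\<close> and \<open>1 = (1 - A) P\<close>, so
    \<open>\<Phi>\<^sub>u\<close> is the Cayley transform of \<open>A\<close>. Skewness of
    \<open>A\<close> then gives \<open>sympl\<close>, as the cross terms cancel and the terms
    quadratic in \<open>A\<close> agree.\<close>
  have W: "\<Phi>\<^sub>u \<theta> v *v y = P y + A (P y)" and id: "y = P y - A (P y)" for y
  proof -
    have "2 *\<^sub>R P y = (\<Phi>\<^sub>u \<theta> v *v y) + y" by (simp add: P_def)
    then have "2 *\<^sub>R P y = 2 *\<^sub>R (y + A (P y))"
      unfolding lin[of y] by (simp add: scaleR_2)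
    then have "P y = y + A (P y)" by simp
    then show "y = P y - A (P y)" "\<Phi>\<^sub>u \<theta> v *v y = P y + A (P y)"
      unfolding lin[of y] by (simp_all add: scaleR_2 algebra_simps)
  qed
  have sympl: "\<omega> (\<Phi>\<^sub>u \<theta> v *v x) (\<Phi>\<^sub>u \<theta> v *v y) = \<omega> x y" for x y
  proof -
    have "\<omega> x y = \<omega> (P x - A (P x)) (P y - A (P y))"
      using id[of x] id[of y] by simp
    then show ?thesis
      unfolding W by (simp add: bil A)
  qed
  have "\<Phi>\<^sub>t \<theta> v = \<epsilon> *\<^sub>R \<psi> \<theta> (mid \<theta> v) + A (\<Phi>\<^sub>t \<theta> v)"
    using linearised_midpoint(2)[OF \<psi>' v, of \<theta>]
    by (simp add: A_def scaleR_add_right blinfun.scaleR_right)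
  then have "\<omega> (P y) (\<Phi>\<^sub>t \<theta> v) = \<omega> (P y) (\<epsilon> *\<^sub>R \<psi> \<theta> (mid \<theta> v) + A (\<Phi>\<^sub>t \<theta> v))"
    by simp
  \<comment> \<open>Skewness turns \<open>1 + A\<close> on the left argument into
    \<open>1 - A\<close> on the right one, and \<open>1 - A\<close> maps
    \<open>\<Phi>\<^sub>t\<close> to \<open>\<epsilon>\<close> times \<open>\<psi>\<close> at the
    midpoint.\<close>
  then have t: "\<omega> (\<Phi>\<^sub>u \<theta> v *v y) (\<Phi>\<^sub>t \<theta> v) = \<epsilon> * \<omega> (P y) (\<psi> \<theta> (mid \<theta> v))"
    unfolding W by (simp add: bil A)
  have "y \<bullet> (J *v pullback_field \<epsilon> f \<Phi> \<theta> v)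
      = \<omega> (\<Phi>\<^sub>u \<theta> v *v y) (\<Phi>\<^sub>u \<theta> v *v pullback_field \<epsilon> f \<Phi> \<theta> v)"
    unfolding sympl by (simp add: \<omega>_def)
  also have "\<dots> = \<omega> (\<Phi>\<^sub>u \<theta> v *v y) (f \<theta> (\<Phi> \<theta> v)) - \<omega> (P y) (\<psi> \<theta> (mid \<theta> v))"
    unfolding pullback_field_eq[OF v] bil t using \<epsilon> by simp
  finally show ?thesis
    unfolding \<omega>_flip(2) P_def by simp
qed

text \<open>The hypothesis provides a continuous \<open>H\<close> with a gradient at each point. As
  that gradient is \<open>J f\<close>, its joint continuity is inherited from \<open>f\<close>,
  which places \<open>H\<close> among the Hamiltonian families. The candidate \<open>K\<close> is
  differentiated by the chain rule, so one derivative of \<open>\<Phi>\<close> is enough.\<close>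

lemma pullback_hamiltonian:
  assumes J: "\<And>x y. (J *v x) \<bullet> y = - (x \<bullet> (J *v y))" "invertible J"
    and "hamiltonian_field J U f"
  shows "hamiltonian_field J V (pullback_field \<epsilon> f \<Phi>)"
proof -
  obtain H where H_per: "\<And>\<theta> u. u \<in> U \<Longrightarrow> H (\<theta> + 1) u = H \<theta> u"
    and H_cont: "continuous_on (UNIV \<times> U) (\<lambda>(\<theta>, u). H \<theta> u)"
    and H_grad: "\<And>\<theta> u. u \<in> U \<Longrightarrow> \<exists>dH. GDERIV (H \<theta>) u :> dH \<and> f \<theta> u = matrix_inv J *v dH"
    using assms(3) unfolding hamiltonian_field_def by blast
  have H_der: "(H \<theta> has_derivative (\<lambda>y. (J *v f \<theta> u) \<bullet> y)) (at u)" if "u \<in> U" for \<theta> u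
    using H_grad[OF that, of \<theta>] matrix_inv_mult(1)[OF J(2)]
    by (auto simp: gderiv_def inner_commute)
  have H: "hamiltonian_family J U f H"
    unfolding hamiltonian_family_def C1_family_def
  proof (intro conjI allI ballI)
    show "continuous_family U (\<lambda>\<theta> u. blinfun_inner_right (J *v f \<theta> u))"
      using bounded_linear.continuous_on[OF bounded_linear_inner_right_matrix
          C1_family_cont(1)[OF f, unfolded continuous_family_def case_prod_beta]]
      by (simp add: continuous_family_def case_prod_beta)
    show "continuous_family U H" using H_cont by (simp add: continuous_family_def)
  qed (use H_der in simp)
  obtain \<eta> where \<eta>: "hamiltonian_family J U \<psi> \<eta>" "\<And>\<theta> u. u \<in> U \<Longrightarrow> \<eta> (\<theta> + 1) u = \<eta> \<theta> u"
    using psi_hamiltonian[OF J(1) H H_per] by blast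
  obtain \<psi>' where \<psi>': "C1_family U \<psi> \<psi>'" using psi_C1 by blast
  define K where "K \<theta> v = H \<theta> (\<Phi> \<theta> v) - \<eta> \<theta> (mid \<theta> v)" for \<theta> v
  have "K (\<theta> + 1) v = K \<theta> v" if "v \<in> V" for \<theta> v
    using that by (simp add: K_def mid_def Phi_periodic H_per Phi_in_U \<eta>(2) mid_in_U[unfolded mid_def])
  moreover have "continuous_on (UNIV \<times> V) (\<lambda>(\<theta>, v). K \<theta> v)"
    unfolding K_def case_prod_beta
    by (intro continuous_on_diff continuous_on_fst continuous_on_id
        continuous_family_compose[OF C1_family_cont(1)[OF H[unfolded hamiltonian_family_def]] _ continuous_on_Phi]
        continuous_family_compose[OF C1_family_cont(1)[OF \<eta>(1)[unfolded hamiltonian_family_def]] _ continuous_on_mid])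
       (auto simp: Phi_in_U mid_in_U)
  moreover have "GDERIV (K \<theta>) v :> J *v pullback_field \<epsilon> f \<Phi> \<theta> v" if v: "v \<in> V" for \<theta> v
  proof -
    have 1: "((\<lambda>v. H \<theta> (\<Phi> \<theta> v)) has_derivative (\<lambda>y. (J *v f \<theta> (\<Phi> \<theta> v)) \<bullet> (\<Phi>\<^sub>u \<theta> v *v y))) (at v)"
      by (rule has_derivative_compose[OF Phi_slice_has_derivative(1)[OF v] H_der[OF Phi_in_U[OF v]]])
    have 2: "((\<lambda>v. \<eta> \<theta> (mid \<theta> v)) has_derivative
        (\<lambda>y. (J *v \<psi> \<theta> (mid \<theta> v)) \<bullet> ((1/2) *\<^sub>R (\<Phi>\<^sub>u \<theta> v *v y + y)))) (at v)"
      using has_derivative_compose[OF Phi_slice_has_derivative(2)[OF v]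
          C1_family_deriv[OF \<eta>(1)[unfolded hamiltonian_family_def] mid_in_U[OF v]]]
      by simp
    show ?thesis
      unfolding gderiv_def K_def[abs_def]
      using has_derivative_diff[OF 1 2] unfolding pullback_gradient[OF J(1) \<psi>' \<eta>(1) v] .
  qed
  ultimately show ?thesis
    unfolding hamiltonian_field_def using matrix_inv_mult(2)[OF J(2)] by metis
qed

end

theorem theorem4p2:
  fixes \<epsilon> :: real
    and f \<Phi> :: "real \<Rightarrow> real ^ 'm \<Rightarrow> real ^ 'm"
    and U V :: "(real ^ 'm) set"
  assumes "0 < \<epsilon>" and "\<epsilon> \<le> 1"
    and "open U" and "open V"
    and "\<And>\<theta> u. u \<in> U \<Longrightarrow> f (\<theta> + 1) u = f \<theta> u"
    and "smooth_field U f"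
    and "midpoint_change_of_variable \<epsilon> U f V \<Phi>"
  shows "(\<forall>I. quadratic_function I \<and> first_integral (\<lambda>t. f (t / \<epsilon>)) U I \<longrightarrow>
              first_integral (\<lambda>t. pullback_field \<epsilon> f \<Phi> (t / \<epsilon>)) V I) \<and>
         (\<forall>\<sigma> :: 'd::finite + 'd \<Rightarrow> 'm.
              bij \<sigma> \<and> hamiltonian_field (symplectic_matrix \<sigma>) U f \<longrightarrow>
              hamiltonian_field (symplectic_matrix \<sigma>) V (pullback_field \<epsilon> f \<Phi>))"
proof -
  obtain f' f'' where "C1_family U f f'" "C1_family U f' f''"
    using assms(6) unfolding smooth_field_def C1_family_def continuous_family_def by blast
  with assms interpret midpoint_change U \<epsilon> f f' f'' V \<Phi>
    by unfold_locales auto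
  show ?thesis
    using pullback_quadratic_integral
      pullback_hamiltonian[OF symplectic_matrix_skew symplectic_matrix_invertible] by blast
qed

end
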